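(* Let $w$ be a weight (not a.e. zero) and $p(\cdot)\in\mathcal P^{\log}_\pm(\mathbb B)$. The following are equivalent: (1) $w\in A_{p(\cdot)}$; (2) $\sup_B\mu_\alpha(B)^{-p_B}\,w(B)\,\|w^{-1}\chi_B\|_{p'(\cdot)/p(\cdot)}<\infty$, the supremum over all pseudo-balls $B$ of $\mathbb B$; (3) $\sup_B\frac{w(B)}{\mu_\alpha(B)}\big(\frac{w'(B)}{\mu_\alpha(B)}\big)^{p_B-1}<\infty$, the supremum over all pseudo-balls $B$ of $\mathbb B$.
   Context: $\mathbb B$ unit ball of $\mathbb C^n$, $\alpha>0$, $d\mu_\alpha(z)=(1-|z|^2)^{\alpha-1}d\mu(z)$. Pseudo-distance $d(z,\zeta)=\big||z|-|\zeta|\big|+\big|1-\frac{\langle z,\zeta\rangle}{|z||\zeta|}\big|$ ($z,\zeta\ne0$), $d(z,\zeta)=|z|+|\zeta|$ otherwise; pseudo-balls $B(z,r)=\{\zeta\in\mathbb B:d(z,\zeta)<r\}$, $z\in\mathbb B,r>0$. $\mathcal P^{\log}_\pm(\mathbb B)$: measurable $p$ with $\operatorname{ess\,inf}p>1$ and $|p(z)-p(\zeta)|\le c/\ln(e+1/d(z,\zeta))$ for some $c$ and all $z\ne\zeta$; $1/p+1/p'=1$. For an exponent $r(\cdot)$ bounded and bounded away from $0$: $\|f\|_{r(\cdot)}=\inf\{\lambda>0:\int|f/\lambda|^{r(z)}d\mu_\alpha\le1\}$. Weights are non-negative locally integrable functions; $w(E)=\int_Ew\,d\mu_\alpha$; $w'=w^{1-p'(\cdot)}$;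 $p_B=\big(\frac1{\mu_\alpha(B)}\int_B\frac1pd\mu_\alpha\big)^{-1}$. $w\in A_{p(\cdot)}$ means $\sup_B\frac1{\mu_\alpha(B)}\|w^{1/p(\cdot)}\chi_B\|_{p(\cdot)}\|w^{-1/p(\cdot)}\chi_B\|_{p'(\cdot)}<\infty$, supremum over all pseudo-balls $B$ of $\mathbb B$. *)

theory Defs
  imports "HOL-Analysis.Analysis"
begin

definition cinner :: "complex^'n \<Rightarrow> complex^'n \<Rightarrow> complex" where
  "cinner z \<zeta> = (\<Sum>i\<in>UNIV. z$i * cnj (\<zeta>$i))"

definition unit_ball :: "(complex^'n) set" where
  "unit_ball = ball 0 1"

definition mu_alpha :: "real \<Rightarrow> (complex^'n) measure" where
  "mu_alpha \<alpha> = density lebesgue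
     (\<lambda>z. indicator unit_ball z * ennreal ((1 - (norm z)^2) powr (\<alpha> - 1)))"

definition pdist :: "complex^'n \<Rightarrow> complex^'n \<Rightarrow> real" where
  "pdist z \<zeta> = (if z \<noteq> 0 \<and> \<zeta> \<noteq> 0
      then \<bar>norm z - norm \<zeta>\<bar> + cmod (1 - cinner z \<zeta> / complex_of_real (norm z * norm \<zeta>))
      else norm z + norm \<zeta>)"

definition pball :: "complex^'n \<Rightarrow> real \<Rightarrow> (complex^'n) set" where
  "pball z r = {\<zeta> \<in> unit_ball. pdist z \<zeta> < r}"

definition pseudo_balls :: "(complex^'n) set set" where
  "pseudo_balls = {pball z r | z r. z \<in> unit_ball \<and> r > 0}"

definition Plog :: "real \<Rightarrow> (complex^'n \<Rightarrow> real) \<Rightarrow> bool" where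
  "Plog \<alpha> p \<longleftrightarrow> p \<in> borel_measurable lebesgue
     \<and> (\<exists>c>1. AE z in mu_alpha \<alpha>. c \<le> p z)
     \<and> (\<exists>c. \<forall>z\<in>unit_ball. \<forall>\<zeta>\<in>unit_ball. z \<noteq> \<zeta> \<longrightarrow>
            \<bar>p z - p \<zeta>\<bar> \<le> c / ln (exp 1 + 1 / pdist z \<zeta>))"

definition conj_exp :: "(complex^'n \<Rightarrow> real) \<Rightarrow> complex^'n \<Rightarrow> real" where
  "conj_exp p z = p z / (p z - 1)"

text \<open>Power of an extended nonnegative number with a positive real exponent
  (infinity to a positive power is infinity).\<close>
definition epow :: "ennreal \<Rightarrow> real \<Rightarrow> ennreal" where
  "epow x r = (if x = top then top else ennreal (enn2real x powr r))"

definition wpow :: "(complex^'n \<Rightarrow> real) \<Rightarrow> (complex^'n \<Rightarrow> real) \<Rightarrow> complex^'n \<Rightarrow> ennreal" where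
  "wpow w s z = (if w z = 0 \<and> s z < 0 then top else ennreal (w z powr s z))"

text \<open>Luxemburg norm of the variable Lebesgue space L^{r(.)}(mu_alpha); inf of empty set = infinity.\<close>
definition varnorm :: "real \<Rightarrow> (complex^'n \<Rightarrow> real) \<Rightarrow> (complex^'n \<Rightarrow> ennreal) \<Rightarrow> ennreal" where
  "varnorm \<alpha> r f = Inf {ennreal t | t. t > 0 \<and>
      (\<integral>\<^sup>+ z. epow (f z / ennreal t) (r z) \<partial>mu_alpha \<alpha>) \<le> 1}"

definition is_weight :: "real \<Rightarrow> (complex^'n \<Rightarrow> real) \<Rightarrow> bool" where
  "is_weight \<alpha> w \<longleftrightarrow> w \<in> borel_measurable lebesgue \<and> (\<forall>z. 0 \<le> w z)
     \<and> (\<forall>K. compact K \<and> K \<subseteq> unit_ball \<longrightarrow> (\<integral>\<^sup>+ z\<in>K. ennreal (w z) \<partial>mu_alpha \<alpha>) < top)"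

definition wmeas :: "real \<Rightarrow> (complex^'n \<Rightarrow> ennreal) \<Rightarrow> (complex^'n) set \<Rightarrow> ennreal" where
  "wmeas \<alpha> v E = (\<integral>\<^sup>+ z\<in>E. v z \<partial>mu_alpha \<alpha>)"

definition pB :: "real \<Rightarrow> (complex^'n \<Rightarrow> real) \<Rightarrow> (complex^'n) set \<Rightarrow> real" where
  "pB \<alpha> p B = inverse ((1 / measure (mu_alpha \<alpha>) B) * (LINT z:B|mu_alpha \<alpha>. 1 / p z))"

definition A_p :: "real \<Rightarrow> (complex^'n \<Rightarrow> real) \<Rightarrow> (complex^'n \<Rightarrow> real) \<Rightarrow> bool" where
  "A_p \<alpha> p w \<longleftrightarrow>
     (SUP B\<in>pseudo_balls. ennreal (1 / measure (mu_alpha \<alpha>) B)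
        * varnorm \<alpha> p (\<lambda>z. wpow w (\<lambda>z. 1 / p z) z * indicator B z)
        * varnorm \<alpha> (conj_exp p) (\<lambda>z. wpow w (\<lambda>z. - 1 / p z) z * indicator B z)) < top"

end

theory Submission
  imports Defs
begin

text \<open>A pseudo-ball of radius \<open>r\<close> has measure at least a constant times a power of \<open>min r 1\<close>, so
  the log-Hoelder condition makes \<open>\<bar>ln x\<bar>\<close> times the oscillation of \<open>1/p\<close> on \<open>B\<close> bounded
  for every quantity \<open>x\<close> lying between two fixed powers of \<open>\<mu>(B)\<close>, up to constants. Each of the three conditions,
  applied to \<open>B = unit_ball\<close>, forces \<open>w\<close> and \<open>w'\<close> to be integrable on the ball, and
  the pointwise inequality \<open>1 \<le> s\<^sup>p w + s\<^sup>-\<^sup>p\<^sup>' w'\<close> then shows that \<open>a = w(B)\<close> and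
  \<open>b = w'(B)\<close> are such quantities. Hence, with \<open>t = p\<^sub>B\<close>, the three norms are comparable to \<open>a\<^sup>1\<^sup>/\<^sup>t\<close>,
  \<open>b\<^sup>1\<^sup>-\<^sup>1\<^sup>/\<^sup>t\<close> and \<open>b\<^sup>t\<^sup>-\<^sup>1\<close>, and all three conditions say that
  \<open>a b\<^sup>t\<^sup>-\<^sup>1 \<mu>(B)\<^sup>-\<^sup>t\<close> is bounded.\<close>

subsection \<open>The measure\<close>

text \<open>Freezing the variable exponent at \<open>t\<close> costs, up to bounded powers, a factor
  x^(1/p(z) - 1/t), so everything hinges on a bound for |ln x| |1/p(z) - 1/t|. For a pseudo-ball of
  radius \<open>r\<close>, log-Hoelder continuity makes the second factor O(1/ln(e + 1/r)), and |ln
  x| may therefore grow only like ln(e + 1/r). The upper bound on a mass is its value on the whole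
  ball. The lower bound is the difficult one, since nothing local prevents \<open>w\<close> from
  being tiny on a small \<open>B\<close>. It comes from duality: where \<open>w\<close> is small,
  \<open>w'\<close> is large, and the total integral of \<open>w'\<close> is finite. The definition
  of a weight asks for integrability only of \<open>w\<close> and only on compact subsets of the
  open ball, so finiteness of the two total integrals has to be extracted from the conditions
  themselves; where it fails, all three suprema are infinite and the equivalences hold for that
  reason.\<close>

lemma sets_mu_alpha [simp, measurable_cong]: "sets (mu_alpha \<alpha>) = sets lebesgue"
  by (simp add: mu_alpha_def)

lemma space_mu_alpha [simp]: "space (mu_alpha \<alpha>) = UNIV"
  by (simp add: mu_alpha_def)

lemma borel_measurable_lebesgueI: "f \<in> borel_measurable borel \<Longrightarrow> f \<in> borel_measurable lebesgue"
  by (rule measurable_completion) simp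

lemma mu_alpha_density_measurable [measurable]:
  "(\<lambda>z::complex^'n. indicator unit_ball z * ennreal ((1 - (norm z)^2) powr (\<alpha> - 1)))
     \<in> borel_measurable lebesgue"
proof (rule borel_measurable_lebesgueI)
  have [measurable]: "unit_ball \<in> sets (borel :: (complex^'n) measure)"
    by (simp add: unit_ball_def)
  show "(\<lambda>z::complex^'n. indicator unit_ball z * ennreal ((1 - (norm z)^2) powr (\<alpha> - 1)))
     \<in> borel_measurable borel"
    by measurable
qed

lemma AE_mu_alpha_unit_ball: "AE z in mu_alpha \<alpha>. z \<in> unit_ball"
  unfolding mu_alpha_def AE_density[OF mu_alpha_density_measurable]
  by (rule AE_I2) (simp split: split_indicator)

text \<open>Bernoulli's inequality bounds 1 - (1 - eps)^d by d eps. This linear decay in the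
  thickness is what offsets the blow-up of the density at the sphere when
  \<open>\<alpha> < 1\<close>.\<close>

lemma emeasure_shell_le:
  fixes \<epsilon> :: real
  assumes "0 \<le> \<epsilon>" "\<epsilon> \<le> 1"
  shows "emeasure lebesgue {z::'a::euclidean_space. 1 - \<epsilon> \<le> norm z \<and> norm z < 1}
           \<le> ennreal (unit_ball_vol DIM('a) * (DIM('a) * \<epsilon>))"
proof -
  have eq: "{z::'a. 1 - \<epsilon> \<le> norm z \<and> norm z < 1} = ball 0 1 - ball 0 (1 - \<epsilon>)" by auto
  have "emeasure lborel (ball (0::'a) 1 - ball 0 (1 - \<epsilon>))
      = emeasure lborel (ball (0::'a) 1) - emeasure lborel (ball (0::'a) (1 - \<epsilon>))"
    using assms by (intro emeasure_Diff) (auto simp: emeasure_ball)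
  also have "\<dots> = ennreal (unit_ball_vol DIM('a) * (1 - (1 - \<epsilon>) ^ DIM('a)))"
    using assms by (simp add: emeasure_ball ennreal_minus[OF mult_nonneg_nonneg[OF less_imp_le[OF unit_ball_vol_pos] zero_le_power]] right_diff_distrib)
  also have "\<dots> \<le> ennreal (unit_ball_vol DIM('a) * (DIM('a) * \<epsilon>))"
    using Bernoulli_inequality[of "-\<epsilon>" "DIM('a)"] assms
    by (intro ennreal_leI mult_left_mono less_imp_le[OF unit_ball_vol_pos]) auto
  finally show ?thesis unfolding eq by simp
qed

text \<open>The single term whose dyadic interval (2^-(k+1), 2^-k] contains \<open>x\<close> already
  dominates. The whole series is kept because its terms are independent of \<open>x\<close>, so that
  it can be integrated term by term.\<close>

lemma powr_le_dyadic_sum: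
  fixes x \<beta> :: real
  assumes x: "0 < x" "x \<le> 1" and \<beta>: "\<beta> \<le> 0"
  shows "ennreal (x powr \<beta>) \<le> (\<Sum>k. ennreal ((1/2) powr (\<beta> * (real k + 1))) * indicator {..(1/2)^k} x)"
proof -
  define k where "k = (LEAST k. (1/2)^(Suc k) < x)"
  obtain j where j: "(1/2)^j < x" using real_arch_pow_inv[of x "1/2"] x by auto
  have "(1/2)^(Suc j) < x"
    using j power_decreasing[of j "Suc j" "1/2::real"] by linarith
  then have k: "(1/2)^(Suc k) < x" unfolding k_def by (rule LeastI)
  have le: "x \<le> (1/2)^k"
  proof (cases k)
    case (Suc i)
    then have "\<not> (1/2)^(Suc i) < x" using not_less_Least[of i "\<lambda>k. (1/2)^(Suc k) < x"] k_def by auto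
    then show ?thesis using Suc by simp
  qed (use x in auto)
  have "x powr \<beta> \<le> ((1/2)^(Suc k)) powr \<beta>" using k \<beta> by (intro powr_mono2') auto
  also have "\<dots> = (1/2) powr (\<beta> * (real k + 1))"
  proof -
    have "(1/2)^(Suc k) = (1/2::real) powr (real k + 1)"
      using powr_realpow[of "1/2" "Suc k"] by (simp add: add.commute)
    then show ?thesis by (simp only: powr_powr mult.commute)
  qed
  finally have "ennreal (x powr \<beta>) \<le> ennreal ((1/2) powr (\<beta> * (real k + 1))) * indicator {..(1/2)^k} x"
    using le by (auto intro: ennreal_leI)
  also have "\<dots> = sum (\<lambda>k. ennreal ((1/2) powr (\<beta> * (real k + 1))) * indicator {..(1/2)^k} x) {k}"
    by (simp only: sum.insert sum.empty finite.emptyI empty_iff not_False_eq_True add_0_right)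
  also have "\<dots> \<le> (\<Sum>k. ennreal ((1/2) powr (\<beta> * (real k + 1))) * indicator {..(1/2)^k} x)"
    by (rule sum_le_suminf) auto
  finally show ?thesis .
qed

text \<open>Shells of thickness 2^-k replace polar coordinates: a shell has measure O(2^-k), the
  density contributes 2^(-k \<beta>), and the resulting geometric series has ratio 2^-(\<beta> + 1),
  which is below 1 because \<open>\<alpha> > 0\<close> forces \<beta> > -1.\<close>

lemma finite_measure_mu_alpha:
  assumes "\<alpha> > 0"
  shows "finite_measure (mu_alpha \<alpha> :: (complex^'n) measure)"
proof
  let ?V = "unit_ball_vol (real DIM(complex^'n)) * DIM(complex^'n)"
  \<comment> \<open>Truncating the exponent at 0 makes the power antitone in its base, so that 1 -
    |z|^2 may be replaced by the smaller 1 - |z|.\<close>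
  define \<beta> where "\<beta> = min (\<alpha> - 1) 0"
  define c where "c k = (1/2::real) powr (\<beta> * (real k + 1))" for k :: nat
  have "emeasure (mu_alpha \<alpha>) (space (mu_alpha \<alpha> :: (complex^'n) measure))
     = (\<integral>\<^sup>+ z. indicator unit_ball z * ennreal ((1 - (norm z)^2) powr (\<alpha> - 1)) \<partial>(lebesgue :: (complex^'n) measure))"
    by (simp add: mu_alpha_def emeasure_density)
  also have "\<dots> \<le> (\<integral>\<^sup>+ z. (\<Sum>k. ennreal (c k) * indicator {z. 1 - (1/2)^k \<le> norm z \<and> norm z < 1} z) \<partial>(lebesgue :: (complex^'n) measure))"
  proof (rule nn_integral_mono)
    fix z :: "complex^'n"
    show "indicator unit_ball z * ennreal ((1 - (norm z)^2) powr (\<alpha> - 1))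
          \<le> (\<Sum>k. ennreal (c k) * indicator {z. 1 - (1/2)^k \<le> norm z \<and> norm z < 1} z)"
    proof (cases "norm z < 1")
      case True
      have sq: "(norm z)^2 \<le> norm z" using True by (simp add: power2_eq_square mult_left_le)
      have "(1 - (norm z)^2) powr (\<alpha> - 1) \<le> (1 - (norm z)^2) powr \<beta>"
        using True sq by (intro powr_mono') (auto simp: \<beta>_def)
      also have "\<dots> \<le> (1 - norm z) powr \<beta>"
        using True sq by (intro powr_mono2') (auto simp: \<beta>_def)
      finally have "ennreal ((1 - (norm z)^2) powr (\<alpha> - 1)) \<le> ennreal ((1 - norm z) powr \<beta>)"
        by (rule ennreal_leI)
      also have "\<dots> \<le> (\<Sum>k. ennreal (c k) * indicator {..(1/2)^k} (1 - norm z))"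
        unfolding c_def using True by (intro powr_le_dyadic_sum) (auto simp: \<beta>_def)
      also have "\<dots> = (\<Sum>k. ennreal (c k) * indicator {z. 1 - (1/2)^k \<le> norm z \<and> norm z < 1} z)"
        using True by (intro suminf_cong) (auto simp: indicator_def)
      finally show ?thesis using True by (simp add: unit_ball_def)
    qed (simp add: unit_ball_def)
  qed
  also have "\<dots> = (\<Sum>k. \<integral>\<^sup>+ z. ennreal (c k) * indicator {z. 1 - (1/2)^k \<le> norm z \<and> norm z < 1} z \<partial>(lebesgue :: (complex^'n) measure))"
    by (intro nn_integral_suminf borel_measurable_lebesgueI) measurable
  also have "\<dots> = (\<Sum>k. ennreal (c k) * emeasure lebesgue {z::complex^'n. 1 - (1/2)^k \<le> norm z \<and> norm z < 1})"
  proof (intro suminf_cong nn_integral_cmult_indicator)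
    fix k
    have "{z::complex^'n. 1 - (1/2)^k \<le> norm z \<and> norm z < 1} \<in> sets borel" by measurable
    then show "{z::complex^'n. 1 - (1/2)^k \<le> norm z \<and> norm z < 1} \<in> sets lebesgue" by simp
  qed
  also have "\<dots> \<le> (\<Sum>k. ennreal (c k) * ennreal (?V * (1/2)^k))"
  proof (intro suminf_le mult_left_mono)
    fix k :: nat
    show "emeasure lebesgue {z::complex^'n. 1 - (1/2)^k \<le> norm z \<and> norm z < 1} \<le> ennreal (?V * (1/2)^k)"
      unfolding mult.assoc by (rule emeasure_shell_le) (auto simp: power_le_one)
  qed auto
  also have "\<dots> = (\<Sum>k. ennreal ((1/2) powr \<beta> * ?V * ((1/2) powr (\<beta> + 1)) ^ k))"
  proof (rule suminf_cong)
    fix k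
    have "((1/2) powr (\<beta> + 1)) ^ k = (1/2::real) powr ((\<beta> + 1) * real k)"
      by (simp add: powr_power mult.commute)
    moreover have "(1/2)^k = (1/2::real) powr real k" using powr_realpow[of "1/2" k] by simp
    ultimately have "c k * (1/2)^k = (1/2) powr \<beta> * ((1/2) powr (\<beta> + 1)) ^ k"
      by (simp only: c_def powr_add[symmetric]) (simp only: algebra_simps mult_1)
    then show "ennreal (c k) * ennreal (?V * (1/2)^k) = ennreal ((1/2) powr \<beta> * ?V * ((1/2) powr (\<beta> + 1)) ^ k)"
      by (simp add: ennreal_mult[symmetric] c_def algebra_simps)
  qed
  also have "\<dots> < top"
  proof -
    have "(1/2::real) powr (\<beta> + 1) < 1 powr (\<beta> + 1)"
      using assms by (intro powr_less_mono2) (auto simp: \<beta>_def)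
    then have "summable (\<lambda>k. (1/2) powr \<beta> * ?V * ((1/2::real) powr (\<beta> + 1)) ^ k)"
      by (intro summable_mult summable_geometric) auto
    then show ?thesis
      by (subst suminf_ennreal_eq[OF _ summable_sums]) (auto simp: less_top[symmetric])
  qed
  finally show "emeasure (mu_alpha \<alpha>) (space (mu_alpha \<alpha> :: (complex^'n) measure)) \<noteq> \<infinity>"
    by simp
qed

subsection \<open>Pseudo-balls\<close>

lemma borel_measurable_pdist [measurable]: "pdist z \<in> borel_measurable borel"
proof -
  have [measurable]: "(\<lambda>\<zeta>. cinner z \<zeta>) \<in> borel_measurable borel"
    unfolding cinner_def by (intro borel_measurable_continuous_onI continuous_intros)
  show ?thesis unfolding pdist_def by measurable
qed

lemma pball_borel: "pball (z :: complex^'n) r \<in> sets borel"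
proof -
  have "pball z r = ball 0 1 \<inter> {\<zeta> \<in> space borel. pdist z \<zeta> < r}"
    by (auto simp: pball_def unit_ball_def)
  also have "\<dots> \<in> sets borel" by (intro sets.Int) measurable
  finally show ?thesis .
qed

lemma pseudo_balls_measurable: "B \<in> pseudo_balls \<Longrightarrow> B \<in> sets lebesgue"
  unfolding pseudo_balls_def using pball_borel by (auto intro!: sets_completionI_sets)

lemma pseudo_balls_subset: "B \<in> pseudo_balls \<Longrightarrow> B \<subseteq> unit_ball"
  by (auto simp: pseudo_balls_def pball_def)

text \<open>Seen from the origin \<open>pdist\<close> is the norm, so radius 2 captures every point.
  This is how a supremum over pseudo-balls yields information on the whole ball.\<close>

lemma unit_ball_pseudo_ball: "unit_ball \<in> (pseudo_balls :: (complex^'n) set set)"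
proof -
  have "unit_ball = pball (0::complex^'n) 2"
    by (auto simp: pball_def pdist_def unit_ball_def)
  moreover have "(0::complex^'n) \<in> unit_ball" by (simp add: unit_ball_def)
  ultimately show ?thesis unfolding pseudo_balls_def mem_Collect_eq
    by (intro exI[of _ 0] exI[of _ 2]) simp
qed

section \<open>The complex inner product and the geometry of the pseudo-distance\<close>

lemma cinner_scaleR_left: "cinner (a *\<^sub>R z) \<zeta> = of_real a * cinner z \<zeta>"
  by (simp add: cinner_def sum_distrib_left scaleR_conv_of_real[where 'a=complex] mult.assoc)

lemma cinner_scaleR_right: "cinner z (a *\<^sub>R \<zeta>) = of_real a * cinner z \<zeta>"
  by (simp add: cinner_def sum_distrib_left scaleR_conv_of_real[where 'a=complex] algebra_simps)

lemma cinner_diff_right: "cinner z (x - y) = cinner z x - cinner z y"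
  by (simp add: cinner_def algebra_simps sum_subtractf)

lemma Re_cinner: "Re (cinner z \<zeta>) = inner z \<zeta>"
  by (simp add: cinner_def inner_vec_def inner_complex_def)

lemma cinner_self: "cinner z z = of_real ((norm z)^2)"
proof -
  have "cinner z z = of_real (\<Sum>i\<in>UNIV. (norm (z$i))^2)"
    by (simp add: cinner_def complex_norm_square[symmetric])
  also have "(\<Sum>i\<in>UNIV. (norm (z$i))^2) = (norm z)^2"
    by (simp add: norm_vec_def L2_set_def sum_nonneg)
  finally show ?thesis .
qed

lemma norm_cinner_le: "cmod (cinner z \<zeta>) \<le> norm z * norm \<zeta>"
proof -
  have "cmod (cinner z \<zeta>) \<le> (\<Sum>i\<in>UNIV. \<bar>cmod (z$i)\<bar> * \<bar>cmod (\<zeta>$i)\<bar>)"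
    unfolding cinner_def by (rule order_trans[OF norm_sum]) (simp add: norm_mult)
  also have "\<dots> \<le> norm z * norm \<zeta>"
    unfolding norm_vec_def by (rule L2_set_mult_ineq)
  finally show ?thesis .
qed

text \<open>Equality case of Cauchy-Schwarz. Separation of points matters because
  \<open>1 / pdist z \<zeta>\<close> would otherwise be read as 1/0 = 0, and the log-Hoelder bound
  would lose its decay.\<close>

lemma pdist_eq_0D:
  assumes "pdist z \<zeta> = 0"
  shows "z = \<zeta>"
proof (cases "z \<noteq> 0 \<and> \<zeta> \<noteq> 0")
  case True
  then have "\<bar>norm z - norm \<zeta>\<bar> + cmod (1 - cinner z \<zeta> / complex_of_real (norm z * norm \<zeta>)) = 0"
    using assms by (simp add: pdist_def)
  then have "\<bar>norm z - norm \<zeta>\<bar> = 0" "cmod (1 - cinner z \<zeta> / complex_of_real (norm z * norm \<zeta>)) = 0"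
    by (metis abs_ge_zero norm_ge_zero add_nonneg_eq_0_iff)+
  then have eq: "norm z = norm \<zeta>" and "1 = cinner z \<zeta> / complex_of_real (norm z * norm \<zeta>)"
    by auto
  then have "cinner z \<zeta> = complex_of_real (norm z * norm \<zeta>)" using True by (simp add: field_simps)
  then have "inner z \<zeta> = norm z * norm \<zeta>" by (metis Re_cinner Re_complex_of_real)
  then have "norm z *\<^sub>R \<zeta> = norm \<zeta> *\<^sub>R z" using norm_cauchy_schwarz_eq by blast
  then show ?thesis using eq True by simp
next
  case False
  then have "norm z + norm \<zeta> = 0" using assms unfolding pdist_def by (simp only: if_False)
  then show ?thesis by (metis add_nonneg_eq_0_iff norm_ge_zero norm_eq_zero)
qed

lemma pdist_nonneg: "0 \<le> pdist z \<zeta>"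
  by (simp add: pdist_def)

text \<open>Moving along the ray of \<open>u\<close> affects only the radial part, so the two radii
  \<open>s\<close> and \<open>t\<close> can be chosen independently. The angular part is |<u, u -
  v>| <= |u - v| with \<open>v\<close> the direction of \<open>\<zeta>\<close>, and normalising
  \<open>\<zeta>\<close> at distance \<open>s\<close> from the origin costs the factor 2/s.\<close>

lemma pdist_scaleR_le:
  fixes u \<zeta> :: "complex^'n"
  assumes u: "norm u = 1" and s: "s > 0" and t: "t > 0" and "\<zeta> \<noteq> 0"
  shows "pdist (t *\<^sub>R u) \<zeta> \<le> \<bar>t - s\<bar> + dist (s *\<^sub>R u) \<zeta> + 2 * dist (s *\<^sub>R u) \<zeta> / s"
proof -
  define v where "v = inverse (norm \<zeta>) *\<^sub>R \<zeta>"
  let ?\<delta> = "dist (s *\<^sub>R u) \<zeta>"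
  have nz: "\<bar>s - norm \<zeta>\<bar> \<le> ?\<delta>"
    using norm_triangle_ineq3[of "s *\<^sub>R u" \<zeta>] u s by (simp add: dist_norm)
  have "cinner (t *\<^sub>R u) \<zeta> / complex_of_real (norm (t *\<^sub>R u) * norm \<zeta>) = cinner u v"
    using u t assms(4) by (simp add: v_def cinner_scaleR_left cinner_scaleR_right field_simps)
  moreover have "1 - cinner u v = cinner u (u - v)"
    using u by (simp add: cinner_diff_right cinner_self)
  ultimately have "cmod (1 - cinner (t *\<^sub>R u) \<zeta> / complex_of_real (norm (t *\<^sub>R u) * norm \<zeta>)) \<le> norm (u - v)"
    using norm_cinner_le[of u "u - v"] u by simp
  also have "norm (u - v) \<le> 2 * ?\<delta> / s"
  proof -
    have "s *\<^sub>R (u - v) = (s *\<^sub>R u - \<zeta>) + (norm \<zeta> - s) *\<^sub>R v"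
      using assms(4) by (simp add: v_def algebra_simps)
    then have "norm (s *\<^sub>R (u - v)) \<le> norm (s *\<^sub>R u - \<zeta>) + norm ((norm \<zeta> - s) *\<^sub>R v)"
      by (metis norm_triangle_ineq)
    also have "norm ((norm \<zeta> - s) *\<^sub>R v) = \<bar>s - norm \<zeta>\<bar>"
      using assms(4) by (simp add: v_def abs_mult mult.assoc)
    also have "norm (s *\<^sub>R u - \<zeta>) + \<bar>s - norm \<zeta>\<bar> \<le> ?\<delta> + ?\<delta>" using nz by (simp add: dist_norm)
    finally have "s * norm (u - v) \<le> 2 * ?\<delta>" using s by simp
    then show ?thesis using s by (simp add: pos_le_divide_eq mult.commute)
  qed
  finally show ?thesis
    using nz t u assms(4) by (auto simp: pdist_def abs_mult)
qed

text \<open>The smaller ball is centred at the point on the ray through \<open>z\<close> whose modulus is \<open>norm z\<close>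
  clipped to \<open>[r/4, 1 - r/4]\<close>: near the origin the angular part of \<open>pdist\<close> is not small,
  near the sphere the weight may degenerate.\<close>

lemma ball_subset_pball:
  fixes z :: "complex^'n"
  assumes z: "z \<in> unit_ball" and r: "0 < r" "r \<le> 1"
  obtains z' where "ball z' (r^2/16) \<subseteq> pball z r" "\<And>\<zeta>. \<zeta> \<in> ball z' (r^2/16) \<Longrightarrow> norm \<zeta> \<le> 1 - r/8"
proof -
  obtain u :: "complex^'n" where u: "norm u = 1" "z = norm z *\<^sub>R u"
  proof (cases "z = 0")
    case True
    obtain e :: "complex^'n" where "norm e = 1" using vector_choose_size[of 1] by auto
    with True that show ?thesis by auto
  next
    case False
    then show ?thesis by (intro that[of "inverse (norm z) *\<^sub>R z"]) auto
  qed
  define s where "s = max (r/4) (min (norm z) (1 - r/4))"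
  have s: "r/4 \<le> s" "s \<le> 1 - r/4" "\<bar>norm z - s\<bar> \<le> r/4"
    using z r by (auto simp: s_def unit_ball_def max_def min_def abs_if)
  have r2: "r^2 \<le> r" using r by (simp add: power2_eq_square mult_left_le)
  have nrm: "norm \<zeta> \<le> 1 - r/8" "r/8 < norm \<zeta>" "\<zeta> \<noteq> 0" "norm \<zeta> < s + r/16"
    if "\<zeta> \<in> ball (s *\<^sub>R u) (r^2/16)" for \<zeta>
  proof -
    have "\<bar>s - norm \<zeta>\<bar> < r^2/16"
      using that norm_triangle_ineq3[of "s *\<^sub>R u" \<zeta>] u s r by (simp add: dist_norm)
    then show "norm \<zeta> \<le> 1 - r/8" "r/8 < norm \<zeta>" "norm \<zeta> < s + r/16" using s r r2 by linarith+
    then show "\<zeta> \<noteq> 0" using r by auto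
  qed
  show ?thesis
  proof
    show "ball (s *\<^sub>R u) (r^2/16) \<subseteq> pball z r"
    proof
      fix \<zeta> assume \<zeta>: "\<zeta> \<in> ball (s *\<^sub>R u) (r^2/16)"
      have "pdist z \<zeta> < r"
      proof (cases "z = 0")
        case True
        then show ?thesis using nrm[OF \<zeta>] s r by (simp add: pdist_def)
      next
        case False
        have d: "dist (s *\<^sub>R u) \<zeta> < r^2/16" using \<zeta> by simp
        \<comment> \<open>The angular part divides by \<open>s\<close>, which may be as small as
          \<open>r/4\<close>; a radius of order \<open>r^2\<close> compensates for this. The three
          summands of \<open>pdist_scaleR_le\<close> are then at most r/4, r/16 and r/2.\<close>
        have "dist (s *\<^sub>R u) \<zeta> / s \<le> (r^2/16) / (r/4)"
          using d s r by (intro frac_le) auto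
        then have "2 * dist (s *\<^sub>R u) \<zeta> / s \<le> r/2" using r by (simp add: power2_eq_square field_simps)
        moreover have "pdist (norm z *\<^sub>R u) \<zeta> \<le> \<bar>norm z - s\<bar> + dist (s *\<^sub>R u) \<zeta> + 2 * dist (s *\<^sub>R u) \<zeta> / s"
          using False s r u nrm[OF \<zeta>] by (intro pdist_scaleR_le) auto
        ultimately show ?thesis unfolding u(2)[symmetric] using s d r r2 by linarith
      qed
      then show "\<zeta> \<in> pball z r" using nrm[OF \<zeta>] r by (simp add: pball_def unit_ball_def)
    qed
  qed (use nrm in auto)
qed

text \<open>On the inscribed Euclidean ball 1 - |\<zeta>|^2 lies between r/8 and 1, so the density
  is at least (r/8)^\<alpha>. The exponent \<open>\<alpha>\<close> instead of
  \<open>\<alpha> - 1\<close> serves both signs of \<open>\<alpha> - 1\<close>; the power of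
  \<open>r\<close> need not be sharp, because only its logarithm is used.\<close>

lemma measure_pball_ge:
  fixes z :: "complex^'n"
  assumes \<alpha>: "\<alpha> > 0" and z: "z \<in> unit_ball" and r: "0 < r" "r \<le> 1"
  shows "(r/8) powr \<alpha> * (unit_ball_vol DIM(complex^'n) * (r^2/16) ^ DIM(complex^'n))
          \<le> measure (mu_alpha \<alpha>) (pball z r)"
proof -
  interpret finite_measure "mu_alpha \<alpha> :: (complex^'n) measure" using finite_measure_mu_alpha[OF \<alpha>] .
  obtain z' where z': "ball z' (r^2/16) \<subseteq> pball z r"
     "\<And>\<zeta>. \<zeta> \<in> ball z' (r^2/16) \<Longrightarrow> norm \<zeta> \<le> 1 - r/8"
    using ball_subset_pball[OF z r] by metis
  have ball_eq: "emeasure lebesgue (ball z' (r^2/16)) = ennreal (unit_ball_vol DIM(complex^'n) * (r^2/16) ^ DIM(complex^'n))"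
    using emeasure_ball[of "r^2/16" z'] by simp
  have "ennreal ((r/8) powr \<alpha>) * emeasure lebesgue (ball z' (r^2/16))
      = (\<integral>\<^sup>+ \<zeta>. ennreal ((r/8) powr \<alpha>) * indicator (ball z' (r^2/16)) \<zeta> \<partial>lebesgue)"
    by (subst nn_integral_cmult_indicator) auto
  also have "\<dots> \<le> (\<integral>\<^sup>+ \<zeta>. indicator unit_ball \<zeta> * ennreal ((1 - (norm \<zeta>)^2) powr (\<alpha> - 1)) * indicator (pball z r) \<zeta> \<partial>lebesgue)"
  proof (rule nn_integral_mono)
    fix \<zeta> :: "complex^'n"
    show "ennreal ((r/8) powr \<alpha>) * indicator (ball z' (r^2/16)) \<zeta>
       \<le> indicator unit_ball \<zeta> * ennreal ((1 - (norm \<zeta>)^2) powr (\<alpha> - 1)) * indicator (pball z r) \<zeta>"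
    proof (cases "\<zeta> \<in> ball z' (r^2/16)")
      case True
      then have n: "norm \<zeta> \<le> 1 - r/8" and "\<zeta> \<in> pball z r" using z' by blast+
      then have m: "\<zeta> \<in> pball z r" "\<zeta> \<in> unit_ball" by (auto simp: pball_def)
      have "(norm \<zeta>)^2 \<le> norm \<zeta>" using n r by (simp add: power2_eq_square mult_left_le)
      then have x: "r/8 \<le> 1 - (norm \<zeta>)^2" using n by linarith
      have "(r/8) powr \<alpha> \<le> (1 - (norm \<zeta>)^2) powr \<alpha>" using x r \<alpha> by (intro powr_mono2) auto
      also have "\<dots> \<le> (1 - (norm \<zeta>)^2) powr (\<alpha> - 1)" using x r by (intro powr_mono') auto
      finally show ?thesis using m True by (auto intro: ennreal_leI)
    qed simp
  qed
  also have "\<dots> = emeasure (mu_alpha \<alpha>) (pball z r)"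
    unfolding mu_alpha_def using pball_borel[of z r]
    by (subst emeasure_density) (auto simp: mu_alpha_density_measurable)
  finally show ?thesis
    by (simp add: ball_eq ennreal_mult[symmetric] emeasure_eq_measure)
qed

section \<open>Log-Hoelder continuity on pseudo-balls\<close>

lemma ln_exp_plus_ge_1: "0 \<le> x \<Longrightarrow> 1 \<le> ln (exp 1 + x :: real)"
  by (subst ln_ge_iff) (auto intro: add_pos_nonneg)

text \<open>Comparison with the value at the origin: the logarithm in the denominator is at least 1,
  so the difference never exceeds |c|.\<close>

lemma Plog_bounded_above:
  assumes "Plog \<alpha> p"
  obtains P where "\<And>z. z \<in> unit_ball \<Longrightarrow> p z \<le> P"
proof -
  obtain c where c: "\<And>z \<zeta>. z \<in> unit_ball \<Longrightarrow> \<zeta> \<in> unit_ball \<Longrightarrow> z \<noteq> \<zeta> \<Longrightarrow>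
      \<bar>p z - p \<zeta>\<bar> \<le> c / ln (exp 1 + 1 / pdist z \<zeta>)"
    using assms by (auto simp: Plog_def)
  show ?thesis
  proof
    fix z :: "complex^'a" assume z: "z \<in> unit_ball"
    show "p z \<le> p 0 + \<bar>c\<bar>"
    proof (cases "z = 0")
      case False
      have "\<bar>p z - p 0\<bar> \<le> c / ln (exp 1 + 1 / pdist z 0)"
        using z False by (intro c) (auto simp: unit_ball_def)
      also have "\<dots> \<le> \<bar>c\<bar> / 1"
        using ln_exp_plus_ge_1[of "1 / pdist z 0"] pdist_nonneg[of z 0] by (intro frac_le) auto
      finally show ?thesis by linarith
    qed simp
  qed
qed

text \<open>Logarithm of \<open>measure_pball_ge\<close>. Since ln(e + 1/r) >= 1, additive constants
  can be absorbed into a pure multiple of it.\<close>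

lemma ln_measure_pball_ge:
  assumes \<alpha>: "\<alpha> > 0"
  obtains C where "C \<ge> 0"
    "\<And>z r. z \<in> (unit_ball :: (complex^'n) set) \<Longrightarrow> r > 0 \<Longrightarrow> 0 < measure (mu_alpha \<alpha>) (pball z r) \<and>
      - C * ln (exp 1 + 1 / r) \<le> ln (measure (mu_alpha \<alpha>) (pball z r))"
proof -
  interpret finite_measure "mu_alpha \<alpha> :: (complex^'n) measure" using finite_measure_mu_alpha[OF \<alpha>] .
  let ?D = "DIM(complex^'n)"
  let ?V = "unit_ball_vol (real ?D)"
  have V: "?V > 0" by simp
  \<comment> \<open>The summands \<open>\<alpha>\<close> and 2 D are the coefficients of ln s in the
    logarithm of the lower bound; the others dominate its constant terms.\<close>
  let ?C = "\<alpha> * ln 8 + \<bar>ln ?V\<bar> + real ?D * ln 16 + \<alpha> + 2 * real ?D"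
  have C: "0 < measure (mu_alpha \<alpha>) (pball z r) \<and>
      - ?C * ln (exp 1 + 1 / r) \<le> ln (measure (mu_alpha \<alpha>) (pball z r))"
    if z: "z \<in> (unit_ball :: (complex^'n) set)" and r: "r > 0" for z r
  proof -
    \<comment> \<open>\<open>measure_pball_ge\<close> covers radii up to 1 only; for a larger radius
      ln s is 0.\<close>
    define s where "s = min r 1"
    have s: "0 < s" "s \<le> 1" "s \<le> r" using r by (auto simp: s_def)
    let ?x = "(s/8) powr \<alpha> * (?V * (s^2/16) ^ ?D)"
    have x: "?x > 0" using s V by simp
    have "?x \<le> measure (mu_alpha \<alpha>) (pball z s)" using measure_pball_ge[OF \<alpha> z s(1,2)] .
    also have "\<dots> \<le> measure (mu_alpha \<alpha>) (pball z r)"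
      using s pball_borel[of z r] by (intro finite_measure_mono) (auto simp: pball_def)
    finally have le: "?x \<le> measure (mu_alpha \<alpha>) (pball z r)" .
    define L where "L = ln (exp 1 + 1 / r)"
    have L: "L \<ge> 1" unfolding L_def using r by (intro ln_exp_plus_ge_1) auto
    have "- ln s \<le> L"
    proof (cases "r \<le> 1")
      case True
      then have "- ln s = ln (1 / r)" using r by (simp add: s_def ln_div)
      also have "\<dots> \<le> L" unfolding L_def using r by (intro ln_mono) auto
      finally show ?thesis .
    qed (use L in \<open>simp add: s_def\<close>)
    then have lns: "ln s \<ge> - L" by simp
    have "ln ?x = ln ((s/8) powr \<alpha>) + ln (?V * (s^2/16) ^ ?D)"
      using s V by (intro ln_mult_pos) auto
    also have "ln (?V * (s^2/16) ^ ?D) = ln ?V + ln ((s^2/16) ^ ?D)"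
      using s V by (intro ln_mult_pos) auto
    also have "ln ((s^2/16) ^ ?D) = real ?D * (2 * ln s - ln 16)"
      using s by (simp add: ln_realpow ln_div)
    also have "ln ((s/8) powr \<alpha>) = \<alpha> * (ln s - ln 8)"
      using s by (simp add: ln_powr ln_div)
    finally have "ln ?x = \<alpha> * ln s + 2 * real ?D * ln s + ln ?V - (\<alpha> * ln 8 + real ?D * ln 16)"
      by (simp add: algebra_simps)
    moreover have "\<alpha> * ln s \<ge> - (\<alpha> * L)" using mult_left_mono[OF lns, of \<alpha>] \<alpha> by simp
    moreover have "2 * real ?D * ln s \<ge> - (2 * real ?D * L)"
      using mult_left_mono[OF lns, of "2 * real ?D"] by simp
    moreover have "\<alpha> * ln 8 + \<bar>ln ?V\<bar> + real ?D * ln 16 \<le> (\<alpha> * ln 8 + \<bar>ln ?V\<bar> + real ?D * ln 16) * L"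
      using mult_left_mono[OF L, of "\<alpha> * ln 8 + \<bar>ln ?V\<bar> + real ?D * ln 16"] \<alpha> by simp
    ultimately have "- ?C * L \<le> ln ?x" by (simp add: algebra_simps)
    also have "\<dots> \<le> ln (measure (mu_alpha \<alpha>) (pball z r))" using x le by (intro ln_mono) auto
    finally show ?thesis using x le unfolding L_def by linarith
  qed
  show ?thesis by (rule that[of ?C]) (use \<alpha> C in auto)
qed

text \<open>A pseudo-ball may have several centres and radii. Hiding \<open>L\<close>, computed from
  one of them, behind an existential quantifier keeps just what is needed later: the growth of |ln
  \<mu>(B)| and the decay of the oscillation are measured by the same number.\<close>

lemma Plog_oscillation:
  fixes p :: "complex^'n \<Rightarrow> real"
  assumes \<alpha>: "\<alpha> > 0" and p: "Plog \<alpha> p"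
  obtains K where "K \<ge> 1"
    "\<And>B. B \<in> (pseudo_balls :: (complex^'n) set set) \<Longrightarrow> 0 < measure (mu_alpha \<alpha>) B"
    "\<And>B. B \<in> pseudo_balls \<Longrightarrow> \<exists>L\<ge>1. \<bar>ln (measure (mu_alpha \<alpha>) B)\<bar> \<le> K * L \<and>
       (\<forall>x\<in>B. \<forall>y\<in>B. \<bar>p x - p y\<bar> \<le> K / L)"
proof -
  interpret finite_measure "mu_alpha \<alpha> :: (complex^'n) measure" using finite_measure_mu_alpha[OF \<alpha>] .
  obtain c where c: "\<And>z \<zeta>. z \<in> unit_ball \<Longrightarrow> \<zeta> \<in> unit_ball \<Longrightarrow> z \<noteq> \<zeta> \<Longrightarrow>
      \<bar>p z - p \<zeta>\<bar> \<le> c / ln (exp 1 + 1 / pdist z \<zeta>)"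
    using p by (auto simp: Plog_def)
  obtain C where C: "C \<ge> 0"
    "\<And>z r. z \<in> (unit_ball :: (complex^'n) set) \<Longrightarrow> r > 0 \<Longrightarrow> 0 < measure (mu_alpha \<alpha>) (pball z r) \<and>
      - C * ln (exp 1 + 1 / r) \<le> ln (measure (mu_alpha \<alpha>) (pball z r))"
    using ln_measure_pball_ge[OF \<alpha>] by blast
  define m1 where "m1 = measure (mu_alpha \<alpha>) (UNIV :: (complex^'n) set)"
  \<comment> \<open>\<open>C\<close> and the total mass \<open>m1\<close> control ln \<mu>(B) from
    below and from above; 2|c| arises because two points are compared through the centre.\<close>
  define K where "K = 1 + C + \<bar>ln m1\<bar> + 2 * \<bar>c\<bar>"
  show ?thesis
  proof
    show "K \<ge> 1" using C by (simp add: K_def)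
  next
    fix B :: "(complex^'n) set" assume "B \<in> pseudo_balls"
    then obtain z r where B: "B = pball z r" "z \<in> unit_ball" "r > 0" by (auto simp: pseudo_balls_def)
    show pos: "0 < measure (mu_alpha \<alpha>) B" using B C by auto
    define L where "L = ln (exp 1 + 1 / r)"
    have L: "L \<ge> 1" unfolding L_def using B by (intro ln_exp_plus_ge_1) auto
    have "ln (measure (mu_alpha \<alpha>) B) \<le> ln m1"
      unfolding m1_def using pos bounded_measure[of B] by (intro ln_mono) auto
    then have "ln (measure (mu_alpha \<alpha>) B) \<le> \<bar>ln m1\<bar> * L"
      using mult_left_mono[OF L, of "\<bar>ln m1\<bar>"] by simp
    moreover have "- (C * L) \<le> ln (measure (mu_alpha \<alpha>) B)" using C(2)[OF B(2,3)] B(1) by (simp add: L_def)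
    moreover have "C * L \<le> K * L" "\<bar>ln m1\<bar> * L \<le> K * L" using L C by (auto simp: K_def intro!: mult_right_mono)
    ultimately have "\<bar>ln (measure (mu_alpha \<alpha>) B)\<bar> \<le> K * L" by linarith
    moreover have "\<bar>p x - p y\<bar> \<le> K / L" if xy: "x \<in> B" "y \<in> B" for x y
    proof -
      have z: "\<bar>p z - p x\<bar> \<le> \<bar>c\<bar> / L" if x: "x \<in> B" for x
      proof (cases "x = z")
        case False
        have "pdist z x \<noteq> 0" using False pdist_eq_0D[of z x] by blast
        then have d: "0 < pdist z x" "pdist z x < r"
          using pdist_nonneg[of z x] x B by (simp_all add: pball_def)
        have "\<bar>p z - p x\<bar> \<le> c / ln (exp 1 + 1 / pdist z x)"
          using False x B by (intro c) (auto simp: pball_def)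
        also have "\<dots> \<le> \<bar>c\<bar> / L"
        proof (rule frac_le)
          show "L \<le> ln (exp 1 + 1 / pdist z x)"
            unfolding L_def using d by (intro ln_mono) (auto intro!: add_pos_pos divide_left_mono)
        qed (use L in auto)
        finally show ?thesis .
      qed (use L in auto)
      have "\<bar>p x - p y\<bar> \<le> \<bar>c\<bar> / L + \<bar>c\<bar> / L" using z[OF xy(1)] z[OF xy(2)] by linarith
      also have "\<dots> = (2 * \<bar>c\<bar>) / L" by simp
      also have "\<dots> \<le> K / L" using L C by (intro divide_right_mono) (auto simp: K_def)
      finally show ?thesis .
    qed
    ultimately show "\<exists>L\<ge>1. \<bar>ln (measure (mu_alpha \<alpha>) B)\<bar> \<le> K * L \<and> (\<forall>x\<in>B. \<forall>y\<in>B. \<bar>p x - p y\<bar> \<le> K / L)"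
      using L by blast
  qed
qed

subsection \<open>Modulars and Luxemburg norms\<close>

lemma epow_0 [simp]: "epow 0 r = 0"
  by (simp add: epow_def)

lemma epow_divide:
  assumes "t > 0"
  shows "epow (x / ennreal t) r = epow x r * ennreal (t powr - r)"
proof (cases x)
  case (real y)
  then show ?thesis using assms
    by (simp add: epow_def divide_ennreal powr_divide powr_minus_divide ennreal_mult[symmetric])
next
  case top
  then show ?thesis using assms by (simp add: epow_def ennreal_top_divide ennreal_top_mult)
qed

text \<open>A positive \<open>r\<close> preserves the sign of the exponent, so the value
  \<open>top\<close> at zeros of \<open>w\<close> occurs on both sides at the same points.\<close>

lemma epow_wpow:
  assumes "w z \<ge> 0" "r > 0"
  shows "epow (wpow w s z * indicator B z) r = wpow w (\<lambda>z. s z * r) z * indicator B z"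
proof (cases "z \<in> B")
  case True
  then show ?thesis
    using assms by (auto simp: wpow_def epow_def powr_powr mult_less_0_iff)
qed simp

lemma measurable_epow:
  assumes [measurable]: "f \<in> borel_measurable M" "r \<in> borel_measurable M"
  shows "(\<lambda>z. epow (f z) (r z)) \<in> borel_measurable M"
  unfolding epow_def by measurable

lemma measurable_wpow:
  assumes [measurable]: "w \<in> borel_measurable M" "s \<in> borel_measurable M"
  shows "wpow w s \<in> borel_measurable M"
  unfolding wpow_def by measurable

lemma varnorm_lessD:
  assumes "varnorm \<alpha> r f < ennreal x"
  obtains t where "t > 0" "t < x" "(\<integral>\<^sup>+ z. epow (f z / ennreal t) (r z) \<partial>mu_alpha \<alpha>) \<le> 1"
  using assms unfolding varnorm_def by (auto simp: Inf_less_iff ennreal_less_iff)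

text \<open>The modular of \<open>f\<close> is at most t^\<rho> times that of f/t when t < 1, and a
  vanishing norm admits arbitrarily small \<open>t\<close>. The result serves to exclude zero
  factors, since 0 times \<open>top\<close> is 0.\<close>

lemma varnorm_eq_0D:
  assumes [measurable]: "f \<in> borel_measurable lebesgue" "r \<in> borel_measurable lebesgue"
    and \<rho>: "\<rho> > 0" "AE z in mu_alpha \<alpha>. \<rho> \<le> r z" and 0: "varnorm \<alpha> r f = 0"
  shows "(\<integral>\<^sup>+ z. epow (f z) (r z) \<partial>mu_alpha \<alpha>) = 0"
proof -
  have [measurable]: "(\<lambda>z. epow (f z / ennreal t) (r z)) \<in> borel_measurable (mu_alpha \<alpha>)" for t
    by (rule measurable_epow) measurable
  have [measurable]: "(\<lambda>z. epow (f z) (r z)) \<in> borel_measurable (mu_alpha \<alpha>)"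
    by (rule measurable_epow) measurable
  have small: "(\<integral>\<^sup>+ z. epow (f z) (r z) \<partial>mu_alpha \<alpha>) \<le> ennreal e" if e: "e > 0" for e
  proof -
    \<comment> \<open>Below 1 the exponent \<open>r z\<close> can be lowered to
      \<open>\<rho>\<close>; below e^(1/\<rho>) the power t^\<rho> is at most
      \<open>e\<close>.\<close>
    have "varnorm \<alpha> r f < ennreal (min 1 (e powr (1/\<rho>)))" unfolding 0 by (rule ennreal_less_zero_iff[THEN iffD2]) (use e in \<open>simp add: min_def\<close>)
    then obtain t where "0 < t" "t < min 1 (e powr (1/\<rho>))"
        and le: "(\<integral>\<^sup>+ z. epow (f z / ennreal t) (r z) \<partial>mu_alpha \<alpha>) \<le> 1"
      by (rule varnorm_lessD)
    then have t: "0 < t" "t < 1" "t < e powr (1/\<rho>)" by simp_all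
    have "(\<integral>\<^sup>+ z. epow (f z) (r z) \<partial>mu_alpha \<alpha>)
        \<le> (\<integral>\<^sup>+ z. ennreal e * epow (f z / ennreal t) (r z) \<partial>mu_alpha \<alpha>)"
    proof (rule nn_integral_mono_AE, use \<rho>(2) in eventually_elim)
      fix z assume r: "\<rho> \<le> r z"
      have "t powr r z \<le> t powr \<rho>" using r t by (intro powr_mono') auto
      also have "\<dots> \<le> (e powr (1/\<rho>)) powr \<rho>" using t \<rho>(1) by (intro powr_mono2) auto
      also have "\<dots> = e" using \<rho>(1) e by (simp add: powr_powr)
      finally have "1 \<le> e * t powr - r z" using t(1) by (simp add: powr_minus_divide pos_le_divide_eq)
      then have "1 \<le> ennreal e * ennreal (t powr - r z)"
        using e by (simp add: ennreal_mult[symmetric])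
      then have "epow (f z) (r z) * 1 \<le> epow (f z) (r z) * (ennreal e * ennreal (t powr - r z))"
        by (rule mult_left_mono) simp
      then show "epow (f z) (r z) \<le> ennreal e * epow (f z / ennreal t) (r z)"
        by (simp only: epow_divide[OF t(1)] mult_ac mult_1_left)
    qed
    also have "\<dots> = ennreal e * (\<integral>\<^sup>+ z. epow (f z / ennreal t) (r z) \<partial>mu_alpha \<alpha>)"
      by (rule nn_integral_cmult) measurable
    also have "\<dots> \<le> ennreal e * 1" using le by (rule mult_left_mono) simp
    finally show ?thesis by simp
  qed
  have "(\<integral>\<^sup>+ z. epow (f z) (r z) \<partial>mu_alpha \<alpha>) \<le> 0"
  proof (rule ennreal_le_epsilon)
    fix e :: real assume "0 < e"
    then show "(\<integral>\<^sup>+ z. epow (f z) (r z) \<partial>mu_alpha \<alpha>) \<le> 0 + ennreal e"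
      unfolding add_0 by (rule small)
  qed
  then show ?thesis by simp
qed

text \<open>For a bounded exponent, t^r(z) is at most max 1 (t^R), so undoing the scaling by
  \<open>t\<close> costs a constant. Applied on the whole ball, this gives integrability of
  \<open>w\<close> and \<open>w'\<close>.\<close>

lemma varnorm_finiteD:
  assumes [measurable]: "f \<in> borel_measurable lebesgue" "r \<in> borel_measurable lebesgue"
    and r: "AE z in mu_alpha \<alpha>. 0 \<le> r z \<and> r z \<le> R" and fin: "varnorm \<alpha> r f < top"
  shows "(\<integral>\<^sup>+ z. epow (f z) (r z) \<partial>mu_alpha \<alpha>) < top"
proof -
  have [measurable]: "(\<lambda>z. epow (f z / ennreal t) (r z)) \<in> borel_measurable (mu_alpha \<alpha>)" for t
    by (rule measurable_epow) measurable
  obtain x where "x > 0" "varnorm \<alpha> r f < ennreal x"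
  proof -
    obtain y where "varnorm \<alpha> r f = ennreal y" "y \<ge> 0" using fin by (cases "varnorm \<alpha> r f") auto
    then show ?thesis by (intro that[of "y + 1"]) (auto simp: ennreal_less_iff)
  qed
  then obtain t where t: "0 < t" "t < x" and le: "(\<integral>\<^sup>+ z. epow (f z / ennreal t) (r z) \<partial>mu_alpha \<alpha>) \<le> 1"
    using varnorm_lessD by metis
  define C where "C = max 1 (t powr R)"
  have C: "C \<ge> 1" "t powr R \<le> C" unfolding C_def by simp_all
  have "(\<integral>\<^sup>+ z. epow (f z) (r z) \<partial>mu_alpha \<alpha>)
      \<le> (\<integral>\<^sup>+ z. ennreal C * epow (f z / ennreal t) (r z) \<partial>mu_alpha \<alpha>)"
  proof (rule nn_integral_mono_AE, use r in eventually_elim)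
    fix z assume r: "0 \<le> r z \<and> r z \<le> R"
    have "t powr r z \<le> C"
    proof (cases "t \<le> 1")
      case True
      then have "t powr r z \<le> t powr 0" using r t by (intro powr_mono') auto
      then show ?thesis using t C by simp
    next
      case False
      then have "t powr r z \<le> t powr R" using r by (intro powr_mono) auto
      then show ?thesis using C by simp
    qed
    then have "1 \<le> C * t powr - r z" using t by (simp add: powr_minus_divide pos_le_divide_eq)
    then have "1 \<le> ennreal C * ennreal (t powr - r z)"
      using C by (simp add: ennreal_mult[symmetric])
    then have "epow (f z) (r z) * 1 \<le> epow (f z) (r z) * (ennreal C * ennreal (t powr - r z))"
      by (rule mult_left_mono) simp
    then show "epow (f z) (r z) \<le> ennreal C * epow (f z / ennreal t) (r z)"
      by (simp only: epow_divide[OF t(1)] mult_ac mult_1_left)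
  qed
  also have "\<dots> = ennreal C * (\<integral>\<^sup>+ z. epow (f z / ennreal t) (r z) \<partial>mu_alpha \<alpha>)"
    by (rule nn_integral_cmult) measurable
  also have "\<dots> \<le> ennreal C * 1" using le by (rule mult_left_mono) simp
  also have "\<dots> < top" by simp
  finally show ?thesis .
qed

text \<open>By \<open>close\<close>, T^r(z) agrees with \<open>b\<close> up to a factor between
  e^-\<kappa> and e^\<kappa> wherever \<open>f\<close> is nonzero, so the modular of f/T is within
  these factors of 1. Because \<open>r z >= \<rho>\<close>, changing \<open>T\<close> by
  exp(\<kappa>/\<rho>) changes T^r(z) by at least e^\<kappa> and pushes the modular to the desired
  side of 1.\<close>

lemma varnorm_bounds:
  fixes f :: "complex^'n \<Rightarrow> ennreal"
  assumes [measurable]: "f \<in> borel_measurable lebesgue" "r \<in> borel_measurable lebesgue"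
    and \<rho>: "\<rho> > 0" "AE z in mu_alpha \<alpha>. \<rho> \<le> r z" and \<kappa>: "\<kappa> \<ge> 0" and T: "T > 0" and b: "b > 0"
    and int: "(\<integral>\<^sup>+ z. epow (f z) (r z) \<partial>mu_alpha \<alpha>) = ennreal b"
    and close: "AE z in mu_alpha \<alpha>. f z \<noteq> 0 \<longrightarrow> \<bar>r z * ln T - ln b\<bar> \<le> \<kappa>"
  shows "ennreal (T * exp (- \<kappa> / \<rho>)) \<le> varnorm \<alpha> r f" "varnorm \<alpha> r f \<le> ennreal (T * exp (\<kappa> / \<rho>))"
proof -
  have [measurable]: "(\<lambda>z. epow (f z) (r z)) \<in> borel_measurable (mu_alpha \<alpha>)"
    by (rule measurable_epow) measurable
  show "varnorm \<alpha> r f \<le> ennreal (T * exp (\<kappa> / \<rho>))"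
  proof -
    let ?t = "T * exp (\<kappa> / \<rho>)"
    have t: "?t > 0" "ln ?t = ln T + \<kappa> / \<rho>" using T by (auto simp: ln_mult)
    have "(\<integral>\<^sup>+ z. epow (f z / ennreal ?t) (r z) \<partial>mu_alpha \<alpha>)
        \<le> (\<integral>\<^sup>+ z. epow (f z) (r z) * ennreal (1 / b) \<partial>mu_alpha \<alpha>)"
    proof (rule nn_integral_mono_AE, use \<rho>(2) close in eventually_elim)
      fix z assume r: "\<rho> \<le> r z" and c: "f z \<noteq> 0 \<longrightarrow> \<bar>r z * ln T - ln b\<bar> \<le> \<kappa>"
      show "epow (f z / ennreal ?t) (r z) \<le> epow (f z) (r z) * ennreal (1 / b)"
      proof (cases "f z = 0")
        case False
        have "\<kappa> = \<rho> * (\<kappa> / \<rho>)" using \<rho> by simp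
        also have "\<dots> \<le> r z * (\<kappa> / \<rho>)" using r \<rho> \<kappa> by (intro mult_right_mono) auto
        finally have "ln b \<le> r z * ln ?t" using c False unfolding t(2) by (simp add: distrib_left)
        then have "exp (- (r z * ln ?t)) \<le> exp (- ln b)" by simp
        also have "exp (- ln b) = 1 / b" using b by (simp add: exp_minus inverse_eq_divide)
        finally have "?t powr - r z \<le> 1 / b" using t(1) T by (simp add: powr_def)
        then show ?thesis unfolding epow_divide[OF t(1)] by (intro mult_left_mono ennreal_leI) auto
      qed simp
    qed
    also have "\<dots> = ennreal b * ennreal (1 / b)" by (simp add: nn_integral_multc int)
    also have "\<dots> = 1" using b by (simp add: ennreal_mult[symmetric])
    finally show ?thesis unfolding varnorm_def using t by (intro Inf_lower) blast
  qed
  show "ennreal (T * exp (- \<kappa> / \<rho>)) \<le> varnorm \<alpha> r f"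
    unfolding varnorm_def
  proof (rule Inf_greatest, clarify)
    fix t :: real assume t: "0 < t" and le: "(\<integral>\<^sup>+ z. epow (f z / ennreal t) (r z) \<partial>mu_alpha \<alpha>) \<le> 1"
    show "ennreal (T * exp (- \<kappa> / \<rho>)) \<le> ennreal t"
    proof (rule ccontr)
      assume "\<not> ?thesis"
      then have "t < T * exp (- \<kappa> / \<rho>)" by (meson ennreal_leI not_le)
      then have "ln t < ln (T * exp (- \<kappa> / \<rho>))" using t by simp
      also have "\<dots> = ln T - \<kappa> / \<rho>" using T by (simp add: ln_mult)
      finally have lt: "ln t < ln T - \<kappa> / \<rho>" .
      \<comment> \<open>The logarithmic gap below the claimed bound; it forces the modular at
        \<open>t\<close> up to at least exp(\<rho> \<delta>) > 1.\<close>
      define \<delta> where "\<delta> = ln T - \<kappa> / \<rho> - ln t"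
      have \<delta>: "\<delta> > 0" "ln t = ln T - (\<kappa> / \<rho> + \<delta>)" using lt by (auto simp: \<delta>_def)
      have "ennreal b * ennreal (exp (\<rho> * \<delta>) / b)
          = (\<integral>\<^sup>+ z. epow (f z) (r z) * ennreal (exp (\<rho> * \<delta>) / b) \<partial>mu_alpha \<alpha>)"
        by (simp add: nn_integral_multc int)
      also have "\<dots> \<le> (\<integral>\<^sup>+ z. epow (f z / ennreal t) (r z) \<partial>mu_alpha \<alpha>)"
      proof (rule nn_integral_mono_AE, use \<rho>(2) close in eventually_elim)
        fix z assume r: "\<rho> \<le> r z" and c: "f z \<noteq> 0 \<longrightarrow> \<bar>r z * ln T - ln b\<bar> \<le> \<kappa>"
        show "epow (f z) (r z) * ennreal (exp (\<rho> * \<delta>) / b) \<le> epow (f z / ennreal t) (r z)"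
        proof (cases "f z = 0")
          case False
          have "\<kappa> + \<rho> * \<delta> = \<rho> * (\<kappa> / \<rho> + \<delta>)" using \<rho> by (simp add: distrib_left)
          also have "\<dots> \<le> r z * (\<kappa> / \<rho> + \<delta>)" using r \<rho> \<kappa> \<delta> by (intro mult_right_mono) auto
          finally have "r z * ln t \<le> ln b - \<rho> * \<delta>"
            using c False unfolding \<delta>(2) by (simp add: right_diff_distrib)
          then have "exp (\<rho> * \<delta> - ln b) \<le> exp (- (r z * ln t))" by simp
          then have "exp (\<rho> * \<delta>) / b \<le> t powr - r z" using t b by (simp add: powr_def exp_diff)
          then show ?thesis unfolding epow_divide[OF t] by (intro mult_left_mono ennreal_leI) auto
        qed simp
      qed
      also have "\<dots> \<le> 1" using le .
      finally have "ennreal (exp (\<rho> * \<delta>)) \<le> 1" using b by (simp add: ennreal_mult[symmetric])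
      then have "\<rho> * \<delta> \<le> 0" by (simp add: ennreal_le_1)
      then show False using mult_pos_pos[OF \<rho>(1) \<delta>(1)] by simp
    qed
  qed
qed

subsection \<open>Masses of a weight and its dual\<close>

text \<open>Integrate \<open>dual\<close> over \<open>B\<close> with \<open>s\<close> so large that
  C/s is at most half the measure of \<open>B\<close>: the other half must then be carried by
  \<open>u\<close>. The functions are left abstract so that a weight and its dual can take either
  role.\<close>

lemma mass_ge_of_dual_pair:
  fixes u v :: "'a \<Rightarrow> ennreal"
  assumes "finite_measure M" and [measurable]: "B \<in> sets M" "u \<in> borel_measurable M" "v \<in> borel_measurable M"
    and C: "C > 0" and m: "measure M B > 0" and a: "a \<ge> 0"
    and dual: "\<And>s. s \<ge> 1 \<Longrightarrow> AE z in M. z \<in> B \<longrightarrow> 1 \<le> ennreal (s powr R) * u z + ennreal (1 / s) * v z"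
    and u: "(\<integral>\<^sup>+ z\<in>B. u z \<partial>M) = ennreal a" and v: "(\<integral>\<^sup>+ z\<in>B. v z \<partial>M) \<le> ennreal C"
  shows "measure M B / 2 \<le> max 1 (2 * C / measure M B) powr R * a"
proof -
  interpret finite_measure M by fact
  define m where "m = measure M B"
  define s where "s = max 1 (2 * C / m)"
  have s: "s \<ge> 1" "2 * C / m \<le> s" by (auto simp: s_def)
  have "ennreal m = (\<integral>\<^sup>+ z. indicator B z \<partial>M)"
    by (simp add: m_def emeasure_eq_measure)
  also have "\<dots> \<le> (\<integral>\<^sup>+ z. ennreal (s powr R) * (u z * indicator B z) + ennreal (1 / s) * (v z * indicator B z) \<partial>M)"
    by (rule nn_integral_mono_AE, use dual[OF s(1)] in eventually_elim) (auto split: split_indicator)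
  also have "\<dots> = ennreal (s powr R) * (\<integral>\<^sup>+ z\<in>B. u z \<partial>M) + ennreal (1 / s) * (\<integral>\<^sup>+ z\<in>B. v z \<partial>M)"
    by (simp add: nn_integral_add nn_integral_cmult)
  also have "\<dots> \<le> ennreal (s powr R) * ennreal a + ennreal (1 / s) * ennreal C"
    unfolding u using v by (intro add_left_mono mult_left_mono) auto
  also have "\<dots> = ennreal (s powr R * a + 1 / s * C)"
    using s a C by (simp add: ennreal_mult[symmetric] ennreal_plus[symmetric] del: ennreal_plus)
  finally have "m \<le> s powr R * a + 1 / s * C"
    using s a C by (subst (asm) ennreal_le_iff) auto
  moreover have "1 / s * C \<le> m / 2"
    using s C m by (simp add: m_def field_simps)
  ultimately show ?thesis unfolding s_def m_def by linarith
qed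

text \<open>The lower bound on \<open>a\<close> is of the order of a power of \<open>m\<close>, and
  \<open>a\<close> is at most \<open>C\<close>; on the logarithmic scale both become linear in 1 +
  |ln m|.\<close>

lemma abs_ln_mass_le:
  fixes a m C R :: real
  assumes m: "m > 0" and C: "C \<ge> 1" and R: "R \<ge> 0" and a: "0 \<le> a" "a \<le> C"
    and le: "m / 2 \<le> max 1 (2 * C / m) powr R * a"
  shows "0 < a \<and> \<bar>ln a\<bar> \<le> (ln C + (R + 1) * (1 + ln (2 * C))) * (1 + \<bar>ln m\<bar>)"
proof -
  let ?s = "max 1 (2 * C / m)"
  have s: "?s > 0" by simp
  have pos: "0 < a"
  proof (rule ccontr)
    assume "\<not> 0 < a"
    then have "a = 0" using a by simp
    then show False using le m by simp
  qed
  have "ln (m / 2) \<le> ln (?s powr R * a)" using m le by (intro ln_mono) auto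
  also have "\<dots> = R * ln ?s + ln a"
    using s pos by (subst ln_mult_pos) (auto simp: ln_powr)
  finally have 1: "ln m - ln 2 \<le> R * ln ?s + ln a" using m by (simp add: ln_div)
  have lnC: "0 \<le> ln C" "ln (2 * C) = ln 2 + ln C" using C by (auto simp: ln_mult)
  have "ln ?s \<le> ln (2 * C) + \<bar>ln m\<bar>"
  proof (cases "2 * C / m \<le> 1")
    case True
    then show ?thesis using lnC by (simp add: max_def)
  next
    case False
    then show ?thesis using C m by (simp add: max_def ln_div)
  qed
  then have "R * ln ?s \<le> R * (ln (2 * C) + \<bar>ln m\<bar>)" using R by (rule mult_left_mono)
  moreover have "ln a \<le> ln C" using pos a by (intro ln_mono) auto
  ultimately have 2: "\<bar>ln a\<bar> \<le> ln C + ln 2 + \<bar>ln m\<bar> + R * (ln (2 * C) + \<bar>ln m\<bar>)"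
    using 1 lnC by (smt (verit) ln_gt_zero mult_nonneg_nonneg R)
  have "\<dots> \<le> (ln C + (R + 1) * (1 + ln (2 * C))) * (1 + \<bar>ln m\<bar>)"
  proof -
    have l: "0 \<le> ln C * \<bar>ln m\<bar>" "0 \<le> R * ln (2 * C) * \<bar>ln m\<bar>" "0 \<le> ln (2 * C) * \<bar>ln m\<bar>"
      using lnC R by (auto intro!: mult_nonneg_nonneg)
    then show ?thesis using lnC R by (simp add: algebra_simps)
  qed
  then show ?thesis using 2 pos by linarith
qed

text \<open>The geometric mean of s^p x and s^-p' x^(1-p') with weights 1/p and 1/p' is 1, so one of
  them is at least 1. As \<open>s >= 1\<close>, they may be enlarged to s^P x and x^(1-p')/s, whose
  powers of \<open>s\<close> are the same for all \<open>p\<close> up to \<open>P\<close>.\<close>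

lemma one_le_powr_mult_add_dual:
  fixes s x p P :: real
  assumes s: "s \<ge> 1" and x: "x > 0" and p: "1 < p" "p \<le> P"
  shows "1 \<le> s powr P * x + 1 / s * x powr (1 - p / (p - 1))"
proof (cases "1 \<le> s powr P * x")
  case False
  then have "x \<le> s powr - P" using s by (simp add: powr_minus_divide pos_le_divide_eq mult.commute)
  also have "\<dots> \<le> s powr - p" using s p by (intro powr_mono) auto
  finally have le: "x \<le> s powr - p" .
  have e: "1 - p / (p - 1) = - 1 / (p - 1)" using p by (simp add: field_simps)
  have "s powr 1 \<le> s powr (p / (p - 1))" using s p by (intro powr_mono) (auto simp: field_simps)
  also have "\<dots> = (s powr - p) powr (1 - p / (p - 1))" unfolding e by (simp add: powr_powr)
  also have "\<dots> \<le> x powr (1 - p / (p - 1))" unfolding e using le x p by (intro powr_mono2') auto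
  finally have "1 \<le> 1 / s * x powr (1 - p / (p - 1))" using s by (simp add: field_simps)
  moreover have "0 \<le> s powr P * x" using x by simp
  ultimately show ?thesis by linarith
next
  case True
  then show ?thesis using s by (simp add: add_increasing2)
qed

text \<open>The same geometric mean argument for s^p' x^(1-p') and s^-p x; here the uniform exponent
  is the conjugate of the lower bound \<open>q\<close>, because p' decreases in p.\<close>

lemma one_le_powr_dual_mult_add:
  fixes s x p q :: real
  assumes s: "s \<ge> 1" and x: "x > 0" and p: "1 < q" "q \<le> p"
  shows "1 \<le> s powr (q / (q - 1)) * x powr (1 - p / (p - 1)) + 1 / s * x"
proof (cases "s \<le> x")
  case False
  have e: "1 - p / (p - 1) = - 1 / (p - 1)" using p by (simp add: field_simps)
  have "1 \<le> s powr (p / (p - 1) + (1 - p / (p - 1)))" using s by simp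
  also have "\<dots> = s powr (p / (p - 1)) * s powr (1 - p / (p - 1))" by (rule powr_add)
  also have "\<dots> \<le> s powr (q / (q - 1)) * x powr (1 - p / (p - 1))"
  proof (rule mult_mono)
    have "p / (p - 1) \<le> q / (q - 1)" using p by (simp add: field_simps)
    then show "s powr (p / (p - 1)) \<le> s powr (q / (q - 1))" using s by (intro powr_mono) auto
    show "s powr (1 - p / (p - 1)) \<le> x powr (1 - p / (p - 1))"
      unfolding e using False x p by (intro powr_mono2') auto
  qed auto
  finally show ?thesis using s x by (simp add: add_increasing2)
next
  case True
  then have "1 \<le> 1 / s * x" using s by simp
  then show ?thesis by (simp add: add_increasing)
qed

text \<open>Replaces finiteness of an extended supremum by boundedness of a comparable real
  quantity, for which powers can be taken freely.\<close>

lemma SUP_less_top_iff_bounded: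
  fixes F :: "'a \<Rightarrow> ennreal" and Y :: "'a \<Rightarrow> real"
  assumes c: "c > 0" and C: "C \<ge> 0" and Y: "\<And>B. B \<in> S \<Longrightarrow> 0 \<le> Y B"
    and lo: "\<And>B. B \<in> S \<Longrightarrow> ennreal (c * Y B) \<le> F B" and hi: "\<And>B. B \<in> S \<Longrightarrow> F B \<le> ennreal (C * Y B)"
  shows "(SUP B\<in>S. F B) < top \<longleftrightarrow> (\<exists>H. \<forall>B\<in>S. Y B \<le> H)"
proof
  assume "(SUP B\<in>S. F B) < top"
  then obtain h where h: "h \<ge> 0" "(SUP B\<in>S. F B) = ennreal h" by (cases "SUP B\<in>S. F B") auto
  have "Y B \<le> h / c" if "B \<in> S" for B
  proof -
    have "ennreal (c * Y B) \<le> ennreal h" using order_trans[OF lo[OF that] SUP_upper[OF that, of F]] unfolding h(2) .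
    then have "c * Y B \<le> h" using h by (subst (asm) ennreal_le_iff) auto
    then show ?thesis using h c by (simp add: pos_le_divide_eq mult.commute)
  qed
  then show "\<exists>H. \<forall>B\<in>S. Y B \<le> H" by blast
next
  assume "\<exists>H. \<forall>B\<in>S. Y B \<le> H"
  then obtain H where H: "\<And>B. B \<in> S \<Longrightarrow> Y B \<le> H" by blast
  have "(SUP B\<in>S. F B) \<le> ennreal (C * H)"
  proof (rule SUP_least)
    fix B assume "B \<in> S"
    then have "F B \<le> ennreal (C * Y B)" "C * Y B \<le> C * H" using hi H C by (auto intro: mult_left_mono)
    then show "F B \<le> ennreal (C * H)" by (meson ennreal_leI order_trans)
  qed
  also have "\<dots> < top" by simp
  finally show "(SUP B\<in>S. F B) < top" .
qed

lemma set_integral_between: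
  fixes h :: "'a \<Rightarrow> real"
  assumes "finite_measure M" "B \<in> sets M" "set_integrable M B h"
    and "AE z in M. z \<in> B \<longrightarrow> l \<le> h z \<and> h z \<le> u"
  shows "l * measure M B \<le> (LINT z:B|M. h z)" "(LINT z:B|M. h z) \<le> u * measure M B"
proof -
  interpret finite_measure M by fact
  have c: "set_integrable M B (\<lambda>_. c)" for c :: real
    using assms(2) by (simp add: set_integrable_def emeasure_eq_measure)
  have "(LINT z:B|M. l) \<le> (LINT z:B|M. h z)"
    using assms by (intro set_integral_mono_AE c) auto
  then show "l * measure M B \<le> (LINT z:B|M. h z)"
    using assms(2) by (simp add: set_lebesgue_integral_def mult.commute)
  have "(LINT z:B|M. h z) \<le> (LINT z:B|M. u)"
    using assms by (intro set_integral_mono_AE c) auto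
  then show "(LINT z:B|M. h z) \<le> u * measure M B"
    using assms(2) by (simp add: set_lebesgue_integral_def mult.commute)
qed

subsection \<open>Comparison of the three conditions\<close>

text \<open>In the assumption \<open>oscillation\<close>, \<open>L\<close> stands for \<open>ln (e + 1/r)\<close> with \<open>r\<close> a radius of \<open>B\<close>.\<close>

locale Plog_weight =
  fixes \<alpha> :: real and w p :: "complex^'n \<Rightarrow> real" and q P K :: real
  assumes \<alpha>: "\<alpha> > 0" and weight: "is_weight \<alpha> w"
    and p_meas [measurable]: "p \<in> borel_measurable lebesgue"
    and q: "q > 1" and AE_q: "AE z in mu_alpha \<alpha>. q \<le> p z"
    and P: "\<And>z. z \<in> unit_ball \<Longrightarrow> p z \<le> P"
    and K: "K \<ge> 1"
    and measure_pos: "\<And>B. B \<in> (pseudo_balls :: (complex^'n) set set) \<Longrightarrow> 0 < measure (mu_alpha \<alpha>) B"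
    and oscillation: "\<And>B. B \<in> pseudo_balls \<Longrightarrow> \<exists>L\<ge>1. \<bar>ln (measure (mu_alpha \<alpha>) B)\<bar> \<le> K * L \<and>
       (\<forall>x\<in>B. \<forall>y\<in>B. \<bar>p x - p y\<bar> \<le> K / L)"
begin

abbreviation M :: "(complex^'n) measure" where "M \<equiv> mu_alpha \<alpha>"
abbreviation v :: "complex^'n \<Rightarrow> ennreal" where "v \<equiv> wpow w (\<lambda>z. 1 - conj_exp p z)"
abbreviation mass :: "(complex^'n) set \<Rightarrow> real" where "mass B \<equiv> enn2real (wmeas \<alpha> (\<lambda>z. ennreal (w z)) B)"
abbreviation dual_mass :: "(complex^'n) set \<Rightarrow> real" where "dual_mass B \<equiv> enn2real (wmeas \<alpha> v B)"

text \<open>\<open>mass\<close> and \<open>dual_mass\<close> read \<open>top\<close> as 0, so they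
  are meaningful only in this case.\<close>

abbreviation finite_masses :: bool where
  "finite_masses \<equiv> wmeas \<alpha> (\<lambda>z. ennreal (w z)) unit_ball < top \<and> wmeas \<alpha> v unit_ball < top"

abbreviation norm_w :: "(complex^'n) set \<Rightarrow> ennreal" where
  "norm_w B \<equiv> varnorm \<alpha> p (\<lambda>z. wpow w (\<lambda>z. 1 / p z) z * indicator B z)"
abbreviation norm_v :: "(complex^'n) set \<Rightarrow> ennreal" where
  "norm_v B \<equiv> varnorm \<alpha> (conj_exp p) (\<lambda>z. wpow w (\<lambda>z. - 1 / p z) z * indicator B z)"
abbreviation norm_inv :: "(complex^'n) set \<Rightarrow> ennreal" where
  "norm_inv B \<equiv> varnorm \<alpha> (\<lambda>z. conj_exp p z / p z) (\<lambda>z. wpow w (\<lambda>_. -1) z * indicator B z)"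

sublocale finite_measure M
  using finite_measure_mu_alpha[OF \<alpha>] .

lemma w_meas [measurable]: "w \<in> borel_measurable lebesgue" and w_nonneg [simp]: "0 \<le> w z"
  using weight by (auto simp: is_weight_def)

lemma conj_exp_meas [measurable]: "conj_exp p \<in> borel_measurable lebesgue"
  unfolding conj_exp_def by measurable

lemma v_meas [measurable]: "v \<in> borel_measurable lebesgue"
  by (rule measurable_wpow) measurable

lemma cut_wpow_meas:
  assumes "B \<in> sets lebesgue" and [measurable]: "s \<in> borel_measurable lebesgue"
  shows "(\<lambda>z. wpow w s z * indicator B z) \<in> borel_measurable lebesgue"
proof -
  have [measurable]: "wpow w s \<in> borel_measurable lebesgue" by (rule measurable_wpow) measurable
  show ?thesis using assms(1) by measurable
qed

lemma AE_p: "AE z in M. z \<in> unit_ball \<and> q \<le> p z \<and> p z \<le> P"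
  using AE_q AE_mu_alpha_unit_ball by eventually_elim (use P in auto)

lemma AE_FalseD:
  assumes "AE z in M. False"
  shows False
proof -
  have "emeasure M UNIV = 0" using assms by (subst (asm) AE_iff_measurable[of UNIV]) auto
  moreover have "measure M unit_ball \<le> measure M UNIV" by (rule bounded_measure[unfolded space_mu_alpha])
  ultimately show False
    using measure_pos[OF unit_ball_pseudo_ball] by (simp add: measure_def)
qed

lemma q_le_P: "q \<le> P"
proof (rule ccontr)
  assume "\<not> q \<le> P"
  have "AE z in M. False" using AE_p by eventually_elim (use \<open>\<not> q \<le> P\<close> in auto)
  then show False by (rule AE_FalseD)
qed

text \<open>Common crude bounds for p, p' and p'/p = 1/(p-1). The lower bound 1/P is dictated by
  p'/p, the only one of the three that can drop below 1.\<close>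

lemma exponent_bounds:
  assumes "z \<in> unit_ball \<and> q \<le> p z \<and> p z \<le> P"
  shows "1 / P \<le> p z" "0 \<le> p z \<and> p z \<le> P"
    "1 / P \<le> conj_exp p z" "0 \<le> conj_exp p z \<and> conj_exp p z \<le> P / (q - 1)"
    "1 / P \<le> conj_exp p z / p z" "0 \<le> conj_exp p z / p z \<and> conj_exp p z / p z \<le> P / (q - 1)"
proof -
  have p: "1 < p z" "1 < P" "q \<le> p z" "p z \<le> P" using assms q by auto
  have P1: "1 / P \<le> 1" using p by simp
  then show "1 / P \<le> p z" "0 \<le> p z \<and> p z \<le> P" using p by linarith+
  have "1 \<le> conj_exp p z" using p by (simp add: conj_exp_def)
  moreover have "conj_exp p z \<le> P / (q - 1)"
    unfolding conj_exp_def using q p by (intro frac_le) auto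
  ultimately show "1 / P \<le> conj_exp p z" "0 \<le> conj_exp p z \<and> conj_exp p z \<le> P / (q - 1)"
    using P1 by linarith+
  have e: "conj_exp p z / p z = 1 / (p z - 1)" using p by (simp add: conj_exp_def)
  show "1 / P \<le> conj_exp p z / p z" unfolding e using p by (intro divide_left_mono) auto
  have "1 / (p z - 1) \<le> P / (q - 1)" using p q by (intro frac_le) auto
  then show "0 \<le> conj_exp p z / p z \<and> conj_exp p z / p z \<le> P / (q - 1)" unfolding e using p by simp
qed

section \<open>Modulars of the three norms\<close>

lemma modular_w:
  "(\<integral>\<^sup>+ z. epow (wpow w (\<lambda>z. 1 / p z) z * indicator B z) (p z) \<partial>M) = wmeas \<alpha> (\<lambda>z. ennreal (w z)) B"
  unfolding wmeas_def
proof (rule nn_integral_cong_AE, use AE_p in eventually_elim)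
  fix z assume "z \<in> unit_ball \<and> q \<le> p z \<and> p z \<le> P"
  then have "p z > 1" using q by simp
  then show "epow (wpow w (\<lambda>z. 1 / p z) z * indicator B z) (p z) = ennreal (w z) * indicator B z"
    by (subst epow_wpow) (auto simp: wpow_def)
qed

text \<open>Since -p'/p = 1 - p', this modular and the one in \<open>modular_inv\<close> are both
  the dual mass: the norms differ only in the exponent used to normalise it.\<close>

lemma modular_v:
  "(\<integral>\<^sup>+ z. epow (wpow w (\<lambda>z. - 1 / p z) z * indicator B z) (conj_exp p z) \<partial>M) = wmeas \<alpha> v B"
  unfolding wmeas_def
proof (rule nn_integral_cong_AE, use AE_p in eventually_elim)
  fix z assume "z \<in> unit_ball \<and> q \<le> p z \<and> p z \<le> P"
  then have p: "p z > 1" using q by simp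
  then have "- 1 / p z * conj_exp p z = 1 - conj_exp p z" "conj_exp p z > 0"
    by (simp_all add: conj_exp_def field_simps)
  then show "epow (wpow w (\<lambda>z. - 1 / p z) z * indicator B z) (conj_exp p z) = v z * indicator B z"
    by (subst epow_wpow) (auto simp: wpow_def)
qed

lemma modular_inv:
  "(\<integral>\<^sup>+ z. epow (wpow w (\<lambda>_. - 1) z * indicator B z) (conj_exp p z / p z) \<partial>M) = wmeas \<alpha> v B"
  unfolding wmeas_def
proof (rule nn_integral_cong_AE, use AE_p in eventually_elim)
  fix z assume "z \<in> unit_ball \<and> q \<le> p z \<and> p z \<le> P"
  then have p: "p z > 1" using q by simp
  then have "- 1 * (conj_exp p z / p z) = 1 - conj_exp p z" "conj_exp p z / p z > 0"
    by (simp_all add: conj_exp_def field_simps)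
  then show "epow (wpow w (\<lambda>_. - 1) z * indicator B z) (conj_exp p z / p z) = v z * indicator B z"
    by (subst epow_wpow) (auto simp: wpow_def)
qed

lemma ball_sets [measurable]: "unit_ball \<in> sets (lebesgue :: (complex^'n) measure)"
  using pseudo_balls_measurable[OF unit_ball_pseudo_ball] .

lemma AE_exponents:
  "AE z in M. 1 / P \<le> p z" "AE z in M. 0 \<le> p z \<and> p z \<le> P"
  "AE z in M. 1 / P \<le> conj_exp p z" "AE z in M. 0 \<le> conj_exp p z \<and> conj_exp p z \<le> P / (q - 1)"
  "AE z in M. 1 / P \<le> conj_exp p z / p z" "AE z in M. 0 \<le> conj_exp p z / p z \<and> conj_exp p z / p z \<le> P / (q - 1)"
  by (rule eventually_mono[OF AE_p], erule exponent_bounds)+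

lemma P_inv_pos: "0 < 1 / P" using q q_le_P by simp

lemma norm_eq_0D:
  assumes "B \<in> sets lebesgue"
  shows "norm_w B = 0 \<Longrightarrow> wmeas \<alpha> (\<lambda>z. ennreal (w z)) B = 0"
    "norm_v B = 0 \<Longrightarrow> wmeas \<alpha> v B = 0" "norm_inv B = 0 \<Longrightarrow> wmeas \<alpha> v B = 0"
  unfolding modular_w[symmetric]
  subgoal by (rule varnorm_eq_0D[OF cut_wpow_meas[OF assms] _ P_inv_pos AE_exponents(1)]) measurable
  unfolding modular_v[symmetric]
  subgoal by (rule varnorm_eq_0D[OF cut_wpow_meas[OF assms] _ P_inv_pos AE_exponents(3)]) measurable
  \<comment> \<open>Two modulars represent the dual mass; here it has to be read as the modular of
    \<open>norm_inv\<close>.\<close>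
  unfolding modular_v modular_inv[symmetric]
  subgoal by (rule varnorm_eq_0D[OF cut_wpow_meas[OF assms] _ P_inv_pos AE_exponents(5)]) measurable
  done

lemma norm_finiteD:
  assumes "B \<in> sets lebesgue"
  shows "norm_w B < top \<Longrightarrow> wmeas \<alpha> (\<lambda>z. ennreal (w z)) B < top"
    "norm_v B < top \<Longrightarrow> wmeas \<alpha> v B < top" "norm_inv B < top \<Longrightarrow> wmeas \<alpha> v B < top"
  unfolding modular_w[symmetric]
  subgoal by (rule varnorm_finiteD[OF cut_wpow_meas[OF assms] _ AE_exponents(2)]) measurable
  unfolding modular_v[symmetric]
  subgoal by (rule varnorm_finiteD[OF cut_wpow_meas[OF assms] _ AE_exponents(4)]) measurable
  unfolding modular_v modular_inv[symmetric]
  subgoal by (rule varnorm_finiteD[OF cut_wpow_meas[OF assms] _ AE_exponents(6)]) measurable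
  done

section \<open>Positivity and size of the masses\<close>

lemma wmeas_w_nonzero:
  assumes "\<not> (AE z in M. w z = 0)"
  shows "wmeas \<alpha> (\<lambda>z. ennreal (w z)) unit_ball \<noteq> 0"
proof
  assume "wmeas \<alpha> (\<lambda>z. ennreal (w z)) unit_ball = 0"
  then have "AE z in M. ennreal (w z) * indicator unit_ball z = 0"
    unfolding wmeas_def by (subst (asm) nn_integral_0_iff_AE) measurable
  then have "AE z in M. w z = 0"
    using AE_mu_alpha_unit_ball by eventually_elim (auto simp: ennreal_eq_0_iff intro: antisym)
  then show False using assms by contradiction
qed

text \<open>The exponent 1 - p' is negative almost everywhere: such a power of a finite positive
  number is positive, and at zeros of \<open>w\<close> the function \<open>wpow\<close> gives
  \<open>top\<close>, not 0.\<close>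

lemma wmeas_v_nonzero: "wmeas \<alpha> v unit_ball \<noteq> 0"
proof
  assume "wmeas \<alpha> v unit_ball = 0"
  then have "AE z in M. v z * indicator unit_ball z = 0"
    unfolding wmeas_def by (subst (asm) nn_integral_0_iff_AE) measurable
  then have "AE z in M. False"
    using AE_p
  proof eventually_elim
    fix z assume "v z * indicator unit_ball z = 0" and z: "z \<in> unit_ball \<and> q \<le> p z \<and> p z \<le> P"
    then have "v z = 0" by simp
    moreover have "1 - conj_exp p z < 0" using z q by (simp add: conj_exp_def field_simps)
    ultimately show False by (auto simp: wpow_def ennreal_eq_0_iff split: if_splits)
  qed
  then show False by (rule AE_FalseD)
qed

text \<open>Monotonicity bounds both masses from above by their values on \<open>unit_ball\<close>.
  Each is bounded below through the finiteness of the other, by \<open>mass_ge_of_dual_pair\<close>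
  with the roles exchanged.\<close>

lemma mass_bounds:
  assumes fin: finite_masses
  obtains Q where "Q \<ge> 0"
    "\<And>B. B \<in> pseudo_balls \<Longrightarrow> wmeas \<alpha> (\<lambda>z. ennreal (w z)) B = ennreal (mass B) \<and> wmeas \<alpha> v B = ennreal (dual_mass B)"
    "\<And>B. B \<in> pseudo_balls \<Longrightarrow> 0 < mass B \<and> \<bar>ln (mass B)\<bar> \<le> Q * (1 + \<bar>ln (measure M B)\<bar>)"
    "\<And>B. B \<in> pseudo_balls \<Longrightarrow> 0 < dual_mass B \<and> \<bar>ln (dual_mass B)\<bar> \<le> Q * (1 + \<bar>ln (measure M B)\<bar>)"
proof -
  define C where "C = mass unit_ball + dual_mass unit_ball + 1"
  have C: "C \<ge> 1" "mass unit_ball \<le> C" "dual_mass unit_ball \<le> C" by (auto simp: C_def)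
  \<comment> \<open>An integrable dual weight cannot be \<open>top\<close> on a set of positive
    measure, so \<open>w\<close> is positive almost everywhere and the real inequalities for
    \<open>x > 0\<close> apply.\<close>
  have "AE z in M. v z * indicator unit_ball z \<noteq> top"
    using fin unfolding wmeas_def
    by (intro nn_integral_PInf_AE[unfolded infinity_ennreal_def]) (auto simp: less_top[symmetric])
  then have AE: "AE z in M. 0 < w z \<and> q \<le> p z \<and> p z \<le> P"
    using AE_p
  proof eventually_elim
    fix z assume f: "v z * indicator unit_ball z \<noteq> top" and z: "z \<in> unit_ball \<and> q \<le> p z \<and> p z \<le> P"
    have "1 - conj_exp p z < 0" using z q by (simp add: conj_exp_def field_simps)
    then have "w z \<noteq> 0" using f z by (auto simp: wpow_def)
    then show "0 < w z \<and> q \<le> p z \<and> p z \<le> P" using z w_nonneg[of z] by (simp add: order_less_le)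
  qed
  \<comment> \<open>One exponent for both directions: it bounds p as well as p', the latter by the
    conjugate of \<open>q\<close>.\<close>
  define R where "R = max P (q / (q - 1))"
  have R: "P \<le> R" "q / (q - 1) \<le> R" "R \<ge> 0" using q q_le_P by (auto simp: R_def)
  have v_eq: "v z = ennreal (w z powr (1 - p z / (p z - 1)))" if "0 < w z" for z
    using that by (simp add: wpow_def conj_exp_def)
  have dual1: "AE z in M. z \<in> B \<longrightarrow> 1 \<le> ennreal (s powr R) * ennreal (w z) + ennreal (1 / s) * v z"
    if s: "s \<ge> 1" for s B
  proof (use AE in eventually_elim, rule impI)
    fix z assume z: "0 < w z \<and> q \<le> p z \<and> p z \<le> P"
    have "1 \<le> s powr R * w z + 1 / s * w z powr (1 - p z / (p z - 1))"
      using s z q R by (intro one_le_powr_mult_add_dual) auto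
    then show "1 \<le> ennreal (s powr R) * ennreal (w z) + ennreal (1 / s) * v z"
      using s z by (simp add: v_eq ennreal_mult[symmetric] ennreal_plus[symmetric] del: ennreal_plus)
  qed
  have dual2: "AE z in M. z \<in> B \<longrightarrow> 1 \<le> ennreal (s powr R) * v z + ennreal (1 / s) * ennreal (w z)"
    if s: "s \<ge> 1" for s B
  proof (use AE in eventually_elim, rule impI)
    fix z assume z: "0 < w z \<and> q \<le> p z \<and> p z \<le> P"
    have "1 \<le> s powr (q / (q - 1)) * w z powr (1 - p z / (p z - 1)) + 1 / s * w z"
      using s z q by (intro one_le_powr_dual_mult_add) auto
    also have "\<dots> \<le> s powr R * w z powr (1 - p z / (p z - 1)) + 1 / s * w z"
      using s R by (intro add_right_mono mult_right_mono powr_mono) auto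
    finally show "1 \<le> ennreal (s powr R) * v z + ennreal (1 / s) * ennreal (w z)"
      using s z by (simp add: v_eq ennreal_mult[symmetric] ennreal_plus[symmetric] del: ennreal_plus)
  qed
  have le_ball: "wmeas \<alpha> u B \<le> wmeas \<alpha> u unit_ball" if "B \<in> pseudo_balls" for u and B :: "(complex^'n) set"
    unfolding wmeas_def using pseudo_balls_subset[OF that]
    by (intro nn_integral_mono) (auto split: split_indicator)
  have eq: "wmeas \<alpha> (\<lambda>z. ennreal (w z)) B = ennreal (mass B)" "wmeas \<alpha> v B = ennreal (dual_mass B)"
    and le: "mass B \<le> C" "dual_mass B \<le> C" if B: "B \<in> pseudo_balls" for B
  proof -
    show "wmeas \<alpha> (\<lambda>z. ennreal (w z)) B = ennreal (mass B)"
      using le_ball[OF B, of "\<lambda>z. ennreal (w z)"] fin by (simp add: order_le_less_trans)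
    show "wmeas \<alpha> v B = ennreal (dual_mass B)"
      using le_ball[OF B, of v] fin by (simp add: order_le_less_trans)
    have "mass B \<le> mass unit_ball"
      using le_ball[OF B, of "\<lambda>z. ennreal (w z)"] fin by (intro enn2real_mono) auto
    then show "mass B \<le> C" using C by simp
    have "dual_mass B \<le> dual_mass unit_ball"
      using le_ball[OF B, of v] fin by (intro enn2real_mono) auto
    then show "dual_mass B \<le> C" using C by simp
  qed
  define Q where "Q = ln C + (R + 1) * (1 + ln (2 * C))"
  show ?thesis
  proof
    show "Q \<ge> 0" using C R unfolding Q_def by (intro add_nonneg_nonneg mult_nonneg_nonneg) auto
  next
    fix B :: "(complex^'n) set" assume B: "B \<in> pseudo_balls"
    show "wmeas \<alpha> (\<lambda>z. ennreal (w z)) B = ennreal (mass B) \<and> wmeas \<alpha> v B = ennreal (dual_mass B)"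
      using eq[OF B] by blast
    have Bs: "B \<in> sets M" using pseudo_balls_measurable[OF B] by simp
    have wm: "(\<lambda>z. ennreal (w z)) \<in> borel_measurable M" "v \<in> borel_measurable M" by measurable
    have iw: "(\<integral>\<^sup>+ z\<in>B. ennreal (w z) \<partial>M) = ennreal (mass B)" and iv: "(\<integral>\<^sup>+ z\<in>B. v z \<partial>M) = ennreal (dual_mass B)"
      using eq[OF B] by (simp_all only: wmeas_def)
    have "measure M B / 2 \<le> max 1 (2 * C / measure M B) powr R * mass B"
      using C le[OF B] by (intro mass_ge_of_dual_pair[OF finite_measure_axioms Bs wm _ measure_pos[OF B] _ dual1 iw])
        (auto simp: iv)
    then show "0 < mass B \<and> \<bar>ln (mass B)\<bar> \<le> Q * (1 + \<bar>ln (measure M B)\<bar>)"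
      unfolding Q_def using C R le[OF B] measure_pos[OF B] by (intro abs_ln_mass_le) auto
    have "measure M B / 2 \<le> max 1 (2 * C / measure M B) powr R * dual_mass B"
      using C le[OF B] by (intro mass_ge_of_dual_pair[OF finite_measure_axioms Bs wm(2,1) _ measure_pos[OF B] _ dual2 iv])
        (auto simp: iw)
    then show "0 < dual_mass B \<and> \<bar>ln (dual_mass B)\<bar> \<le> Q * (1 + \<bar>ln (measure M B)\<bar>)"
      unfolding Q_def using C R le[OF B] measure_pos[OF B] by (intro abs_ln_mass_le) auto
  qed
qed

text \<open>The reciprocal of p_B is the mean of 1/p over \<open>B\<close>, hence lies between the
  essential bounds of 1/p and differs from each value on \<open>B\<close> by at most the
  oscillation. The oscillation of 1/p is no larger than that of p because p > 1.\<close>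

lemma pB_bounds:
  assumes B: "B \<in> pseudo_balls"
  shows "q \<le> pB \<alpha> p B" "pB \<alpha> p B \<le> P"
    "\<exists>L\<ge>1. \<bar>ln (measure M B)\<bar> \<le> K * L \<and> (AE z in M. z \<in> B \<longrightarrow> \<bar>1 / p z - 1 / pB \<alpha> p B\<bar> \<le> K / L)"
proof -
  let ?m = "measure M B"
  define I where "I = (LINT z:B|M. 1 / p z)"
  have Bs: "B \<in> sets M" using pseudo_balls_measurable[OF B] by simp
  have m: "?m > 0" using measure_pos[OF B] .
  have P0: "0 < P" using q q_le_P by simp
  have pB: "1 / pB \<alpha> p B = I / ?m" by (simp add: pB_def I_def inverse_eq_divide)
  have "integrable M (\<lambda>z. indicator B z * (1 / p z))"
  proof (rule integrable_const_bound[of _ 1])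
    show "AE z in M. norm (indicator B z * (1 / p z)) \<le> 1"
      using AE_p by eventually_elim (use q in \<open>auto split: split_indicator\<close>)
    show "(\<lambda>z. indicator B z * (1 / p z)) \<in> borel_measurable M" using Bs by measurable
  qed
  then have int: "set_integrable M B (\<lambda>z. 1 / p z)" by (simp add: set_integrable_def)
  have AE1: "AE z in M. z \<in> B \<longrightarrow> 1 / P \<le> 1 / p z \<and> 1 / p z \<le> 1 / q"
    using AE_p by eventually_elim (use q in \<open>auto intro!: divide_left_mono\<close>)
  have le: "1 / P \<le> 1 / pB \<alpha> p B" "1 / pB \<alpha> p B \<le> 1 / q"
    using set_integral_between[OF finite_measure_axioms Bs int AE1] m unfolding pB I_def[symmetric]
    by (simp_all only: pos_le_divide_eq pos_divide_le_eq)
  have "0 < 1 / pB \<alpha> p B" by (rule less_le_trans[OF _ le(1)]) (use P0 in simp)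
  then have "pB \<alpha> p B > 0" by simp
  then show "q \<le> pB \<alpha> p B" "pB \<alpha> p B \<le> P"
    using le_imp_inverse_le[OF le(1)] le_imp_inverse_le[OF le(2)] q P0 by simp_all
  obtain L where L: "L \<ge> 1" "\<bar>ln ?m\<bar> \<le> K * L" and osc: "\<And>x y. x \<in> B \<Longrightarrow> y \<in> B \<Longrightarrow> \<bar>p x - p y\<bar> \<le> K / L"
    using oscillation[OF B] by blast
  have "AE z in M. z \<in> B \<longrightarrow> \<bar>1 / p z - 1 / pB \<alpha> p B\<bar> \<le> K / L"
    using AE_p
  proof (eventually_elim, intro impI)
    fix z assume z: "z \<in> unit_ball \<and> q \<le> p z \<and> p z \<le> P" and zB: "z \<in> B"
    \<comment> \<open>With \<open>z\<close> fixed, averaging these bounds over \<open>y\<close>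
      turns 1/p(y) into the reciprocal of p_B.\<close>
    have "AE y in M. y \<in> B \<longrightarrow> 1 / p z - K / L \<le> 1 / p y \<and> 1 / p y \<le> 1 / p z + K / L"
      using AE_p
    proof (eventually_elim, intro impI)
      fix y assume y: "y \<in> unit_ball \<and> q \<le> p y \<and> p y \<le> P" and yB: "y \<in> B"
      have p: "1 < p z" "1 < p y" using y z q by auto
      then have "1 * 1 \<le> p z * p y" by (intro mult_mono) auto
      then have "1 \<le> p z * p y" by simp
      have "\<bar>1 / p z - 1 / p y\<bar> = \<bar>p y - p z\<bar> / (p z * p y)"
        using p by (simp add: diff_frac_eq abs_divide abs_mult)
      also have "\<dots> \<le> \<bar>p y - p z\<bar> / 1" using \<open>1 \<le> p z * p y\<close> by (intro frac_le) auto
      also have "\<dots> \<le> K / L" using osc[OF yB zB] by simp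
      finally show "1 / p z - K / L \<le> 1 / p y \<and> 1 / p y \<le> 1 / p z + K / L" by linarith
    qed
    from set_integral_between[OF finite_measure_axioms Bs int this]
    have "1 / p z - K / L \<le> I / ?m" "I / ?m \<le> 1 / p z + K / L"
      using m unfolding I_def[symmetric] by (simp_all only: pos_le_divide_eq pos_divide_le_eq)
    then show "\<bar>1 / p z - 1 / pB \<alpha> p B\<bar> \<le> K / L" unfolding pB by linarith
  qed
  with L show "\<exists>L\<ge>1. \<bar>ln ?m\<bar> \<le> K * L \<and> (AE z in M. z \<in> B \<longrightarrow> \<bar>1 / p z - 1 / pB \<alpha> p B\<bar> \<le> K / L)" by blast
qed

text \<open>\<open>varnorm_bounds\<close> is applied with the value that each norm would have for
  the constant exponent p_B; its closeness hypothesis is where the logarithmic growth of the masses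
  meets the decay of the oscillation.\<close>

lemma norm_estimates:
  assumes fin: finite_masses
  obtains \<kappa> where
    "\<And>B. B \<in> pseudo_balls \<Longrightarrow> wmeas \<alpha> (\<lambda>z. ennreal (w z)) B = ennreal (mass B) \<and> wmeas \<alpha> v B = ennreal (dual_mass B)
        \<and> 0 < mass B \<and> 0 < dual_mass B"
    "\<And>B. B \<in> pseudo_balls \<Longrightarrow> ennreal (mass B powr (1 / pB \<alpha> p B) * exp (- \<kappa>)) \<le> norm_w B
        \<and> norm_w B \<le> ennreal (mass B powr (1 / pB \<alpha> p B) * exp \<kappa>)"
    "\<And>B. B \<in> pseudo_balls \<Longrightarrow> ennreal (dual_mass B powr (1 - 1 / pB \<alpha> p B) * exp (- \<kappa>)) \<le> norm_v B
        \<and> norm_v B \<le> ennreal (dual_mass B powr (1 - 1 / pB \<alpha> p B) * exp \<kappa>)"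
    "\<And>B. B \<in> pseudo_balls \<Longrightarrow> ennreal (dual_mass B powr (pB \<alpha> p B - 1) * exp (- \<kappa>)) \<le> norm_inv B
        \<and> norm_inv B \<le> ennreal (dual_mass B powr (pB \<alpha> p B - 1) * exp \<kappa>)"
proof -
  obtain Q where Q: "Q \<ge> 0"
    and eq: "\<And>B. B \<in> pseudo_balls \<Longrightarrow> wmeas \<alpha> (\<lambda>z. ennreal (w z)) B = ennreal (mass B) \<and> wmeas \<alpha> v B = ennreal (dual_mass B)"
    and a: "\<And>B. B \<in> pseudo_balls \<Longrightarrow> 0 < mass B \<and> \<bar>ln (mass B)\<bar> \<le> Q * (1 + \<bar>ln (measure M B)\<bar>)"
    and b: "\<And>B. B \<in> pseudo_balls \<Longrightarrow> 0 < dual_mass B \<and> \<bar>ln (dual_mass B)\<bar> \<le> Q * (1 + \<bar>ln (measure M B)\<bar>)"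
    using mass_bounds[OF fin] by blast
  define R where "R = P / (q - 1)"
  have R: "R \<ge> 0" using q q_le_P by (simp add: R_def)
  have P0: "P \<ge> 0" using q q_le_P by simp
  \<comment> \<open>Dominates the coefficients p, p' and p' t that occur below, where
    \<open>R\<close> bounds both p' and p'/p.\<close>
  define c0 where "c0 = P + R + R * P * P"
  have c0: "P \<le> c0" "R \<le> c0" "R * P * P \<le> c0" "c0 \<ge> 0" using P0 R by (auto simp: c0_def)
  \<comment> \<open>The product of \<open>c0\<close>, K/L and Q (1 + K) L: the two occurrences of
    \<open>L\<close> cancel, which makes the bound independent of \<open>B\<close>.\<close>
  define \<kappa> where "\<kappa> = c0 * K * (Q * (1 + K))"
  have \<kappa>: "\<kappa> \<ge> 0" using c0 K Q by (simp add: \<kappa>_def)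
  \<comment> \<open>With t = p_B, the three differences equal (1/p - 1/t) ln x times -p, p' and p'
    t, respectively.\<close>
  have key: "AE z in M. z \<in> B \<longrightarrow> \<bar>p z * ln (x powr (1 / pB \<alpha> p B)) - ln x\<bar> \<le> \<kappa>
      \<and> \<bar>conj_exp p z * ln (x powr (1 - 1 / pB \<alpha> p B)) - ln x\<bar> \<le> \<kappa>
      \<and> \<bar>conj_exp p z / p z * ln (x powr (pB \<alpha> p B - 1)) - ln x\<bar> \<le> \<kappa>"
    if B: "B \<in> pseudo_balls" and x: "0 < x" "\<bar>ln x\<bar> \<le> Q * (1 + \<bar>ln (measure M B)\<bar>)" for B x
  proof -
    define t where "t = pB \<alpha> p B"
    have t: "q \<le> t" "t \<le> P" using pB_bounds[OF B] by (auto simp: t_def)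
    obtain L where L: "L \<ge> 1" "\<bar>ln (measure M B)\<bar> \<le> K * L"
      and AE_L: "AE z in M. z \<in> B \<longrightarrow> \<bar>1 / p z - 1 / t\<bar> \<le> K / L"
      using pB_bounds(3)[OF B] unfolding t_def by blast
    have "1 + \<bar>ln (measure M B)\<bar> \<le> (1 + K) * L" using L by (simp add: distrib_right)
    then have lnx: "\<bar>ln x\<bar> \<le> Q * (1 + K) * L"
      using mult_left_mono[OF _ Q] x(2) by (smt (verit) mult.assoc)
    have bound: "\<bar>c * d * ln x\<bar> \<le> \<kappa>" if "\<bar>c\<bar> \<le> c0" "\<bar>d\<bar> \<le> K / L" for c d
    proof -
      have "\<bar>c * d * ln x\<bar> \<le> c0 * (K / L) * (Q * (1 + K) * L)"
        unfolding abs_mult using that lnx c0 K L by (intro mult_mono) auto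
      also have "\<dots> = \<kappa>" using L by (simp add: \<kappa>_def)
      finally show ?thesis .
    qed
    show ?thesis unfolding t_def[symmetric] using AE_p AE_L
    proof (eventually_elim, intro impI conjI)
      fix z assume z: "z \<in> unit_ball \<and> q \<le> p z \<and> p z \<le> P"
        and "z \<in> B \<longrightarrow> \<bar>1 / p z - 1 / t\<bar> \<le> K / L" and zB: "z \<in> B"
      then have d: "\<bar>1 / p z - 1 / t\<bar> \<le> K / L" by blast
      have p: "1 < p z" "0 < t" using z q t by auto
      have "p z * ln (x powr (1 / t)) - ln x = (- p z) * (1 / p z - 1 / t) * ln x"
        using p x by (simp add: ln_powr field_simps)
      moreover have "\<bar>- p z\<bar> \<le> c0" using z c0 p by simp
      ultimately show "\<bar>p z * ln (x powr (1 / t)) - ln x\<bar> \<le> \<kappa>" using bound d by metis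
      have "conj_exp p z * ln (x powr (1 - 1 / t)) - ln x = conj_exp p z * (1 / p z - 1 / t) * ln x"
        using p x by (simp add: ln_powr conj_exp_def field_simps)
      moreover have "\<bar>conj_exp p z\<bar> \<le> c0" using exponent_bounds(4)[OF z] c0 by (simp add: R_def)
      ultimately show "\<bar>conj_exp p z * ln (x powr (1 - 1 / t)) - ln x\<bar> \<le> \<kappa>" using bound d by metis
      have "conj_exp p z / p z * ln (x powr (t - 1)) - ln x
          = (conj_exp p z / p z * p z * t) * (1 / p z - 1 / t) * ln x"
        using p x by (simp add: ln_powr conj_exp_def field_simps)
      moreover have "\<bar>conj_exp p z / p z * p z * t\<bar> \<le> c0"
      proof -
        have "\<bar>conj_exp p z / p z * p z * t\<bar> \<le> R * P * P"
          unfolding abs_mult using exponent_bounds(6)[OF z] z p t R P0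
          by (intro mult_mono mult_nonneg_nonneg) (auto simp: R_def)
        then show ?thesis using c0 by simp
      qed
      ultimately show "\<bar>conj_exp p z / p z * ln (x powr (t - 1)) - ln x\<bar> \<le> \<kappa>" using bound d by metis
    qed
  qed
  have cut: "AE z in M. g z * indicator B z \<noteq> 0 \<longrightarrow> H z" if "AE z in M. z \<in> B \<longrightarrow> H z"
    for g :: "complex^'n \<Rightarrow> ennreal" and B H
    using that by eventually_elim (auto split: split_indicator)
  have e: "- \<kappa> / (1 / P) = - (\<kappa> * P)" "\<kappa> / (1 / P) = \<kappa> * P" by simp_all
  show ?thesis
  \<comment> \<open>The exponents are only known to be at least 1/P, so
    \<open>varnorm_bounds\<close> divides \<open>\<kappa>\<close> by 1/P.\<close>
  proof (rule that[of "\<kappa> * P"])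
    fix B :: "(complex^'n) set" assume B: "B \<in> pseudo_balls"
    note Bs = pseudo_balls_measurable[OF B]
    show "wmeas \<alpha> (\<lambda>z. ennreal (w z)) B = ennreal (mass B) \<and> wmeas \<alpha> v B = ennreal (dual_mass B)
        \<and> 0 < mass B \<and> 0 < dual_mass B"
      using eq[OF B] a[OF B] b[OF B] by blast
    have 1: "AE z in M. wpow w (\<lambda>z. 1 / p z) z * indicator B z \<noteq> 0 \<longrightarrow>
        \<bar>p z * ln (mass B powr (1 / pB \<alpha> p B)) - ln (mass B)\<bar> \<le> \<kappa>"
      by (rule cut) (use key[OF B, of "mass B"] a[OF B] in \<open>auto elim: eventually_mono\<close>)
    have 2: "AE z in M. wpow w (\<lambda>z. - 1 / p z) z * indicator B z \<noteq> 0 \<longrightarrow>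
        \<bar>conj_exp p z * ln (dual_mass B powr (1 - 1 / pB \<alpha> p B)) - ln (dual_mass B)\<bar> \<le> \<kappa>"
      by (rule cut) (use key[OF B, of "dual_mass B"] b[OF B] in \<open>auto elim: eventually_mono\<close>)
    have 3: "AE z in M. wpow w (\<lambda>_. - 1) z * indicator B z \<noteq> 0 \<longrightarrow>
        \<bar>conj_exp p z / p z * ln (dual_mass B powr (pB \<alpha> p B - 1)) - ln (dual_mass B)\<bar> \<le> \<kappa>"
      by (rule cut) (use key[OF B, of "dual_mass B"] b[OF B] in \<open>auto elim: eventually_mono\<close>)
    have pos: "0 < mass B powr (1 / pB \<alpha> p B)" "0 < dual_mass B powr (1 - 1 / pB \<alpha> p B)"
      "0 < dual_mass B powr (pB \<alpha> p B - 1)" "0 < mass B" "0 < dual_mass B" using a[OF B] b[OF B] by auto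
    have ms: "(\<lambda>z. wpow w (\<lambda>z. 1 / p z) z * indicator B z) \<in> borel_measurable lebesgue"
      "(\<lambda>z. wpow w (\<lambda>z. - 1 / p z) z * indicator B z) \<in> borel_measurable lebesgue"
      "(\<lambda>z. wpow w (\<lambda>_. - 1) z * indicator B z) \<in> borel_measurable lebesgue"
      by ((rule cut_wpow_meas[OF Bs], measurable)[1])+
    have cp: "(\<lambda>z. conj_exp p z / p z) \<in> borel_measurable lebesgue" by measurable
    note w = varnorm_bounds[OF ms(1) p_meas P_inv_pos AE_exponents(1) \<kappa> pos(1) pos(4) _ 1, unfolded e]
    show "ennreal (mass B powr (1 / pB \<alpha> p B) * exp (- (\<kappa> * P))) \<le> norm_w B
        \<and> norm_w B \<le> ennreal (mass B powr (1 / pB \<alpha> p B) * exp (\<kappa> * P))"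
      using w eq[OF B] modular_w[of B] by simp
    note v = varnorm_bounds[OF ms(2) conj_exp_meas P_inv_pos AE_exponents(3) \<kappa> pos(2) pos(5) _ 2, unfolded e]
    show "ennreal (dual_mass B powr (1 - 1 / pB \<alpha> p B) * exp (- (\<kappa> * P))) \<le> norm_v B
        \<and> norm_v B \<le> ennreal (dual_mass B powr (1 - 1 / pB \<alpha> p B) * exp (\<kappa> * P))"
      using v eq[OF B] modular_v[of B] by simp
    note i = varnorm_bounds[OF ms(3) cp P_inv_pos AE_exponents(5) \<kappa> pos(3) pos(5) _ 3, unfolded e]
    show "ennreal (dual_mass B powr (pB \<alpha> p B - 1) * exp (- (\<kappa> * P))) \<le> norm_inv B
        \<and> norm_inv B \<le> ennreal (dual_mass B powr (pB \<alpha> p B - 1) * exp (\<kappa> * P))"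
      using i eq[OF B] modular_inv[of B] by simp
  qed
qed

section \<open>Comparison of the three suprema\<close>

abbreviation A_p_quotient :: "(complex^'n) set \<Rightarrow> ennreal" where
  "A_p_quotient B \<equiv> ennreal (1 / measure M B) * norm_w B * norm_v B"
abbreviation inverse_quotient :: "(complex^'n) set \<Rightarrow> ennreal" where
  "inverse_quotient B \<equiv> ennreal (measure M B powr (- pB \<alpha> p B)) * wmeas \<alpha> (\<lambda>z. ennreal (w z)) B * norm_inv B"
abbreviation mean_quotient :: "(complex^'n) set \<Rightarrow> ennreal" where
  "mean_quotient B \<equiv> wmeas \<alpha> (\<lambda>z. ennreal (w z)) B / ennreal (measure M B)
     * epow (wmeas \<alpha> v B / ennreal (measure M B)) (pB \<alpha> p B - 1)"

text \<open>The first quotient is comparable to \<open>X\<close>, the second to \<open>J\<close>,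
  and the third equals \<open>J\<close>. Moreover \<open>J\<close> is the p_B-th power of
  \<open>X\<close>, and as p_B stays between \<open>q\<close> and \<open>P\<close>, one is bounded
  over all pseudo-balls exactly when the other is.\<close>

lemma quotients_equivalent:
  assumes fin: finite_masses
  shows "(SUP B\<in>pseudo_balls. A_p_quotient B) < top \<longleftrightarrow> (SUP B\<in>pseudo_balls. inverse_quotient B) < top"
    and "(SUP B\<in>pseudo_balls. A_p_quotient B) < top \<longleftrightarrow> (SUP B\<in>pseudo_balls. mean_quotient B) < top"
proof -
  obtain \<kappa> where
    eq: "\<And>B. B \<in> pseudo_balls \<Longrightarrow> wmeas \<alpha> (\<lambda>z. ennreal (w z)) B = ennreal (mass B) \<and> wmeas \<alpha> v B = ennreal (dual_mass B)
        \<and> 0 < mass B \<and> 0 < dual_mass B"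
    and W: "\<And>B. B \<in> pseudo_balls \<Longrightarrow> ennreal (mass B powr (1 / pB \<alpha> p B) * exp (- \<kappa>)) \<le> norm_w B
        \<and> norm_w B \<le> ennreal (mass B powr (1 / pB \<alpha> p B) * exp \<kappa>)"
    and V: "\<And>B. B \<in> pseudo_balls \<Longrightarrow> ennreal (dual_mass B powr (1 - 1 / pB \<alpha> p B) * exp (- \<kappa>)) \<le> norm_v B
        \<and> norm_v B \<le> ennreal (dual_mass B powr (1 - 1 / pB \<alpha> p B) * exp \<kappa>)"
    and I: "\<And>B. B \<in> pseudo_balls \<Longrightarrow> ennreal (dual_mass B powr (pB \<alpha> p B - 1) * exp (- \<kappa>)) \<le> norm_inv B
        \<and> norm_inv B \<le> ennreal (dual_mass B powr (pB \<alpha> p B - 1) * exp \<kappa>)"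
    using norm_estimates[OF fin] by blast
  define X where "X B = 1 / measure M B * mass B powr (1 / pB \<alpha> p B) * dual_mass B powr (1 - 1 / pB \<alpha> p B)" for B
  define J where "J B = measure M B powr (- pB \<alpha> p B) * mass B * dual_mass B powr (pB \<alpha> p B - 1)" for B
  have X0: "0 \<le> X B" and J0: "0 \<le> J B" for B by (simp_all add: X_def J_def)
  have 1: "(SUP B\<in>pseudo_balls. A_p_quotient B) < top \<longleftrightarrow> (\<exists>H. \<forall>B\<in>pseudo_balls. X B \<le> H)"
  proof (rule SUP_less_top_iff_bounded[where c = "exp (- \<kappa>) * exp (- \<kappa>)" and C = "exp \<kappa> * exp \<kappa>"])
    fix B :: "(complex^'n) set" assume B: "B \<in> pseudo_balls"
    have prod: "ennreal (s * s * X B) = ennreal (1 / measure M B) * ennreal (mass B powr (1 / pB \<alpha> p B) * s)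
        * ennreal (dual_mass B powr (1 - 1 / pB \<alpha> p B) * s)" if "s > 0" for s
      using that by (simp add: ennreal_mult[symmetric] X_def mult_ac)
    show "ennreal (exp (- \<kappa>) * exp (- \<kappa>) * X B) \<le> A_p_quotient B"
      unfolding prod[OF exp_gt_zero] using W[OF B] V[OF B] by (intro mult_mono) auto
    show "A_p_quotient B \<le> ennreal (exp \<kappa> * exp \<kappa> * X B)"
      unfolding prod[OF exp_gt_zero] using W[OF B] V[OF B] by (intro mult_mono) auto
  qed (auto simp: X0)
  have 2: "(SUP B\<in>pseudo_balls. inverse_quotient B) < top \<longleftrightarrow> (\<exists>H. \<forall>B\<in>pseudo_balls. J B \<le> H)"
  proof (rule SUP_less_top_iff_bounded[where c = "exp (- \<kappa>)" and C = "exp \<kappa>"])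
    fix B :: "(complex^'n) set" assume B: "B \<in> pseudo_balls"
    have prod: "ennreal (s * J B) = ennreal (measure M B powr (- pB \<alpha> p B)) * wmeas \<alpha> (\<lambda>z. ennreal (w z)) B
        * ennreal (dual_mass B powr (pB \<alpha> p B - 1) * s)" if "s > 0" for s
    proof -
      obtain a where "wmeas \<alpha> (\<lambda>z. ennreal (w z)) B = ennreal a" "0 \<le> a"
        using eq[OF B] by (metis enn2real_nonneg)
      then show ?thesis using that by (simp add: ennreal_mult[symmetric] J_def mult_ac)
    qed
    show "ennreal (exp (- \<kappa>) * J B) \<le> inverse_quotient B"
      unfolding prod[OF exp_gt_zero] using I[OF B] by (intro mult_mono) auto
    show "inverse_quotient B \<le> ennreal (exp \<kappa> * J B)"
      unfolding prod[OF exp_gt_zero] using I[OF B] by (intro mult_mono) auto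
  qed (auto simp: J0)
  have 3: "(SUP B\<in>pseudo_balls. mean_quotient B) < top \<longleftrightarrow> (\<exists>H. \<forall>B\<in>pseudo_balls. J B \<le> H)"
  proof (rule SUP_less_top_iff_bounded[where c = 1 and C = 1])
    fix B :: "(complex^'n) set" assume B: "B \<in> pseudo_balls"
    have m: "0 < measure M B" using measure_pos[OF B] .
    have "mean_quotient B = ennreal (mass B / measure M B * (dual_mass B / measure M B) powr (pB \<alpha> p B - 1))"
    proof -
      obtain a where "wmeas \<alpha> (\<lambda>z. ennreal (w z)) B = ennreal a" "0 \<le> a"
        using eq[OF B] by (metis enn2real_nonneg)
      moreover obtain b where "wmeas \<alpha> v B = ennreal b" "0 \<le> b"
        using eq[OF B] by (metis enn2real_nonneg)
      ultimately show ?thesis using m by (simp add: divide_ennreal epow_def ennreal_mult[symmetric])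
    qed
    also have "mass B / measure M B * (dual_mass B / measure M B) powr (pB \<alpha> p B - 1) = J B"
      using eq[OF B] m by (simp add: J_def powr_divide powr_diff powr_minus_divide)
    finally show "ennreal (1 * J B) \<le> mean_quotient B" "mean_quotient B \<le> ennreal (1 * J B)" by simp_all
  qed (auto simp: J0)
  have JX: "J B = X B powr pB \<alpha> p B" if B: "B \<in> pseudo_balls" for B
  proof -
    have t: "pB \<alpha> p B > 1" using pB_bounds(1)[OF B] q by simp
    have m: "0 < measure M B" using measure_pos[OF B] .
    have "(1 - 1 / pB \<alpha> p B) * pB \<alpha> p B = pB \<alpha> p B - 1" using t by (simp add: left_diff_distrib)
    then show ?thesis
      using t m eq[OF B] by (simp add: X_def J_def powr_mult powr_powr powr_divide powr_minus_divide)
  qed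
  have "(\<exists>H. \<forall>B\<in>pseudo_balls. X B \<le> H) \<longleftrightarrow> (\<exists>H. \<forall>B\<in>pseudo_balls. J B \<le> H)"
  proof (intro iffI; elim exE)
    fix H assume H: "\<forall>B\<in>pseudo_balls. X B \<le> H"
    \<comment> \<open>A base of at least 1 is what allows the exponent p_B to be raised to
      \<open>P\<close>.\<close>
    have "J B \<le> max 1 H powr P" if B: "B \<in> pseudo_balls" for B
    proof -
      have "J B \<le> max 1 H powr pB \<alpha> p B"
        unfolding JX[OF B] using H B X0 pB_bounds(1)[OF B] q by (intro powr_mono2) (auto simp: le_max_iff_disj)
      also have "\<dots> \<le> max 1 H powr P" using pB_bounds(2)[OF B] by (intro powr_mono) auto
      finally show ?thesis .
    qed
    then show "\<exists>H. \<forall>B\<in>pseudo_balls. J B \<le> H" by blast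
  next
    fix H assume H: "\<forall>B\<in>pseudo_balls. J B \<le> H"
    \<comment> \<open>If \<open>X B\<close> exceeds 1, raising it to the power p_B > 1 only
      increases it, so it is at most \<open>J B\<close>.\<close>
    have "X B \<le> max 1 H" if B: "B \<in> pseudo_balls" for B
    proof (rule ccontr)
      assume "\<not> X B \<le> max 1 H"
      then have X: "X B > 1" "X B > H" by auto
      then have "X B powr 1 \<le> X B powr pB \<alpha> p B" using pB_bounds(1)[OF B] q by (intro powr_mono) auto
      then show False using X H B JX[OF B] by fastforce
    qed
    then show "\<exists>H. \<forall>B\<in>pseudo_balls. X B \<le> H" by blast
  qed
  then show "(SUP B\<in>pseudo_balls. A_p_quotient B) < top \<longleftrightarrow> (SUP B\<in>pseudo_balls. inverse_quotient B) < top"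
    and "(SUP B\<in>pseudo_balls. A_p_quotient B) < top \<longleftrightarrow> (SUP B\<in>pseudo_balls. mean_quotient B) < top"
    unfolding 1 2 3 by simp_all
qed

text \<open>A finite product bounds a factor only if the other factors are nonzero. Positivity of
  both masses supplies this, since a vanishing norm would force the corresponding mass to
  vanish.\<close>

lemma finite_masses_of_quotient:
  assumes nz: "\<not> (AE z in M. w z = 0)"
    and fin: "A_p_quotient unit_ball < top \<or> inverse_quotient unit_ball < top \<or> mean_quotient unit_ball < top"
  shows finite_masses
proof -
  have m: "0 < measure M unit_ball" using measure_pos[OF unit_ball_pseudo_ball] .
  note w0 = wmeas_w_nonzero[OF nz] and v0 = wmeas_v_nonzero
  note n0 = norm_eq_0D[OF ball_sets] and nf = norm_finiteD[OF ball_sets]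
  from fin show ?thesis
  proof (elim disjE)
    assume "A_p_quotient unit_ball < top"
    then have "norm_w unit_ball < top" "norm_v unit_ball < top"
      using m n0(1,2) w0 v0 by (auto simp: ennreal_mult_less_top mult.assoc)
    then show ?thesis using nf by blast
  next
    assume "inverse_quotient unit_ball < top"
    then have "wmeas \<alpha> (\<lambda>z. ennreal (w z)) unit_ball < top" "norm_inv unit_ball < top"
      using m n0(3) w0 v0 by (auto simp: ennreal_mult_less_top mult.assoc)
    then show ?thesis using nf by blast
  next
    assume f: "mean_quotient unit_ball < top"
    have t: "pB \<alpha> p unit_ball - 1 > 0" using pB_bounds(1)[OF unit_ball_pseudo_ball] q by simp
    have v: "wmeas \<alpha> v unit_ball / ennreal (measure M unit_ball) \<noteq> 0"
      using v0 by (simp add: ennreal_divide_eq_0_iff)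
    have "epow (wmeas \<alpha> v unit_ball / ennreal (measure M unit_ball)) (pB \<alpha> p unit_ball - 1) \<noteq> 0"
      using v by (auto simp: epow_def enn2real_eq_0_iff ennreal_eq_0_iff)
    moreover have "wmeas \<alpha> (\<lambda>z. ennreal (w z)) unit_ball / ennreal (measure M unit_ball) \<noteq> 0"
      using w0 by (simp add: ennreal_divide_eq_0_iff)
    ultimately have 1: "wmeas \<alpha> (\<lambda>z. ennreal (w z)) unit_ball / ennreal (measure M unit_ball) < top"
      and 2: "epow (wmeas \<alpha> v unit_ball / ennreal (measure M unit_ball)) (pB \<alpha> p unit_ball - 1) < top"
      using f by (auto simp: ennreal_mult_less_top)
    have "wmeas \<alpha> (\<lambda>z. ennreal (w z)) unit_ball < top"
      using 1 m by (metis ennreal_top_divide less_top ennreal_neq_top)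
    moreover have "wmeas \<alpha> v unit_ball < top"
      using 2 m by (metis ennreal_top_divide less_top ennreal_neq_top epow_def)
    ultimately show ?thesis by blast
  qed
qed

end

theorem mainTheorem11:
  fixes \<alpha> :: real and w p :: "complex^'n \<Rightarrow> real"
  assumes "\<alpha> > 0"
    and "is_weight \<alpha> w"
    and "\<not> (AE z in mu_alpha \<alpha>. w z = 0)"
    and "Plog \<alpha> p"
  shows "(A_p \<alpha> p w \<longleftrightarrow>
          (SUP B\<in>pseudo_balls. ennreal (measure (mu_alpha \<alpha>) B powr (- pB \<alpha> p B))
             * wmeas \<alpha> (\<lambda>z. ennreal (w z)) B
             * varnorm \<alpha> (\<lambda>z. conj_exp p z / p z) (\<lambda>z. wpow w (\<lambda>_. -1) z * indicator B z)) < top)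
       \<and> (A_p \<alpha> p w \<longleftrightarrow>
          (SUP B\<in>pseudo_balls. wmeas \<alpha> (\<lambda>z. ennreal (w z)) B / ennreal (measure (mu_alpha \<alpha>) B)
             * epow (wmeas \<alpha> (wpow w (\<lambda>z. 1 - conj_exp p z)) B / ennreal (measure (mu_alpha \<alpha>) B))
                    (pB \<alpha> p B - 1)) < top)"
proof -
  obtain q where q: "q > 1" "AE z in mu_alpha \<alpha>. q \<le> p z" and pm: "p \<in> borel_measurable lebesgue"
    using assms(4) by (auto simp: Plog_def)
  obtain P where P: "\<And>z. z \<in> unit_ball \<Longrightarrow> p z \<le> P" using Plog_bounded_above[OF assms(4)] by blast
  obtain K where K: "K \<ge> 1"
    "\<And>B. B \<in> (pseudo_balls :: (complex^'n) set set) \<Longrightarrow> 0 < measure (mu_alpha \<alpha>) B"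
    "\<And>B. B \<in> pseudo_balls \<Longrightarrow> \<exists>L\<ge>1. \<bar>ln (measure (mu_alpha \<alpha>) B)\<bar> \<le> K * L \<and>
       (\<forall>x\<in>B. \<forall>y\<in>B. \<bar>p x - p y\<bar> \<le> K / L)"
    using Plog_oscillation[OF assms(1,4)] by blast
  interpret Plog_weight \<alpha> w p q P K
    using assms(1,2) pm q P K by unfold_locales
  have at_ball: "F unit_ball < top" if "(SUP B\<in>pseudo_balls. F B) < top" for F :: "(complex^'n) set \<Rightarrow> ennreal"
    using SUP_upper[OF unit_ball_pseudo_ball, of F] that by (rule le_less_trans)
  show ?thesis
  \<comment> \<open>If a total mass is infinite, each quotient is already infinite at
    \<open>unit_ball\<close>, so all three conditions fail together.\<close>
  proof (cases finite_masses)
    case True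
    then show ?thesis unfolding A_p_def using quotients_equivalent by blast
  next
    case False
    then have "\<not> A_p_quotient unit_ball < top" "\<not> inverse_quotient unit_ball < top" "\<not> mean_quotient unit_ball < top"
      using finite_masses_of_quotient[OF assms(3)] by blast+
    then show ?thesis unfolding A_p_def
      using at_ball[of A_p_quotient] at_ball[of inverse_quotient] at_ball[of mean_quotient] by blast
  qed
qed

end
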